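(* Let $\mathbb{G}=(I,\Delta)$ be a discrete quantum semigroup which is left amenable or right amenable. Then the noncommutative additive functional equation has Hyers-Ulam stability on $\mathbb{G}$; that is, for every $r>0$ there is $r'>0$ such that whenever $f\in\mathbf{F}(\mathbb{G})$ satisfies $$\|\Delta(f)-1\otimes f-f\otimes 1\|<r',$$ there exists $F\in\mathbf{F}(\mathbb{G})$ with $$\Delta(F)=1\otimes F+F\otimes 1\qquad\text{and}\qquad \|F-f\|<r.$$
   Context: Index systems and function algebras. $\mathcal{M}_n$ is the C*-algebra of complex $n\times n$ matrices (with operator norm). An index system is a set $I$ together with a function $n_I$ from $I$ to the positive integers; for $\gamma\in I$ write $\mathcal{M}_\gamma=\mathcal{M}_{n_I(\gamma)}$, with identity matrix $1_\gamma$. $\mathbf{F}(I)=\prod_{\gamma\in I}\mathcal{M}_\gamma$ is the *-algebra (pointwise operations) of all functions $f$ on $I$ with $f(\gamma)\in\mathcal{M}_\gamma$; its unit is $1$, $1(\gamma)=1_\gamma$. For $f\in\mathbf{F}(I)$ put $\|f\|=\sup_{\gamma\in I}\|f(\gamma)\|\in[0,\infty]$; $\mathbf{F}_{\mathrm b}(I)$ is the *-subalgebra of those $f$ with $\|f\|<\infty$, a C*-algebra (indeed a von Neumann algebra) with this norm. A product $I\times J$ of index systems is an index system with $n_{I\times J}(\alpha,\beta)=n_I(\alpha)n_J(\beta)$, and $\mathcal{M}_{(\alpha,\beta)}$ is identified with $\mathcal{M}_\alpha\otimes\mathcal{M}_\beta$. For $f\in\mathbf{F}(I)$, $g\in\mathbf{F}(J)$,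 $f\otimes g\in\mathbf{F}(I\times J)$ is $(\alpha,\beta)\mapsto f(\alpha)\otimes g(\beta)$. An inequality $\|h\|<r'$ for $h\in\mathbf{F}(I\times I)$ or $\mathbf{F}(I)$ means in particular that $h$ is bounded. Discrete quantum semigroups. A comultiplication for $I$ is a collection of (not necessarily unital) *-homomorphisms $\Delta^\alpha_{\beta,\gamma}:\mathcal{M}_\alpha\to\mathcal{M}_\beta\otimes\mathcal{M}_\gamma$, one for each $(\alpha,\beta,\gamma)\in I^3$, such that (i) $\Delta^\alpha_{\beta,\gamma}(1_\alpha)\Delta^{\alpha'}_{\beta,\gamma}(1_{\alpha'})=0$ for $\alpha\neq\alpha'$; and (ii) for all $\lambda,\alpha,\beta,\gamma\in I$, $\sum_{\omega\in I}(\Delta^\omega_{\alpha,\beta}\otimes\iota)\Delta^\lambda_{\omega,\gamma}=\sum_{\omega\in I}(\iota\otimes\Delta^\omega_{\beta,\gamma})\Delta^\lambda_{\alpha,\omega}$ as maps $\mathcal{M}_\lambda\to\mathcal{M}_\alpha\otimes\mathcal{M}_\beta\otimes\mathcal{M}_\gamma$, where $\iota$ denotes identity maps. (By (i), for fixed $\beta,\gamma$ only finitely many $\alpha$ have $\Delta^\alpha_{\beta,\gamma}\ne0$, so the sums make sense.) The collection defines a *-homomorphism $\Delta:\mathbf{F}(I)\to\mathbf{F}(I\times I)$, $[\Delta(f)](\beta,\gamma)=\sum_{\alpha}\Delta^\alpha_{\beta,\gamma}(f(\alpha))$, which maps $\mathbf{F}_{\mathrm b}(I)$ into $\mathbf{F}_{\mathrm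 b}(I\times I)$. A discrete quantum semigroup is a pair $\mathbb{G}=(I,\Delta)$ with $I$ an index system and $\Delta$ a comultiplication for $I$. Write $\mathbf{F}(\mathbb{G})=\mathbf{F}(I)$, $\mathbf{F}_{\mathrm b}(\mathbb{G})=\mathbf{F}_{\mathrm b}(I)$. Amenability. Let $\mathfrak{m}$ be a linear functional on $\mathbf{F}_{\mathrm b}(I)$ and $g\in\mathbf{F}_{\mathrm b}(I\times I)$. With $\{e^{ij}_\beta\}$ the standard matrix units of $\mathcal{M}_\beta$, write $g(\alpha,\beta)=\sum_{ij}g^{ij}_\beta(\alpha)\otimes e^{ij}_\beta$ with $g^{ij}_\beta\in\mathbf{F}_{\mathrm b}(I)$, and define $(\mathfrak{m}\tilde\otimes\iota)(g)\in\mathbf{F}(I)$ by $[(\mathfrak{m}\tilde\otimes\iota)(g)](\beta)=\sum_{ij}\mathfrak{m}(g^{ij}_\beta)e^{ij}_\beta$; $(\iota\tilde\otimes\mathfrak{m})(g)$ is defined similarly by applying $\mathfrak{m}$ in the second variable. $\mathbb{G}$ is right amenable if there is a state $\mathfrak{m}$ on $\mathbf{F}_{\mathrm b}(\mathbb{G})$ (a right invariant mean) with $(\mathfrak{m}\tilde\otimes\iota)\Delta(f)=\mathfrak{m}(f)1$ for all $f\in\mathbf{F}_{\mathrm b}(\mathbb{G})$; it is left amenable if there is a state $\mathfrak{m}$ with $(\iota\tilde\otimes\mathfrak{m})\Delta(f)=\mathfrak{m}(f)1$ for all $f\in\mathbf{F}_{\mathrm b}(\mathbb{G})$. *)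

theory Defs
  imports
    "Jordan_Normal_Form.Schur_Decomposition"
    "HOL-Library.Function_Algebras"
    "HOL-Library.Groups_Big_Fun"
    "HOL-Library.Extended_Nonnegative_Real"
    "HOL-Analysis.L2_Norm"
begin

text \<open>
  The C*-algebra of complex \<open>k \<times> k\<close> matrices is \<open>carrier_mat k k\<close>. The index set of an index
  system is the type \<open>'i\<close>, and \<open>n :: 'i \<Rightarrow> nat\<close> is its dimension function; the
  product index system has the dimension function \<open>(\<alpha>, \<beta>) \<mapsto> n \<alpha> * n \<beta>\<close>. Addition, subtraction
  and multiplication of functions on an index system are the pointwise ones of
  \<open>HOL-Library.Function_Algebras\<close>.
\<close>

definition index_system :: "('i \<Rightarrow> nat) \<Rightarrow> bool" where
  "index_system n \<longleftrightarrow> (\<forall>\<gamma>. n \<gamma> > 0)"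


subsection \<open>Matrices\<close>

definition vec_l2norm :: "complex vec \<Rightarrow> real" where
  "vec_l2norm v = L2_set (\<lambda>i. cmod (v $ i)) {..<dim_vec v}"

definition opnorm :: "complex mat \<Rightarrow> real" where
  "opnorm A = Sup {vec_l2norm (A *\<^sub>v v) | v. v \<in> carrier_vec (dim_col A) \<and> vec_l2norm v \<le> 1}"

text \<open>
  The tensor product of matrix algebras is realised by the Kronecker product, the pair of indices
  \<open>(k, i)\<close> with \<open>i < c\<close> being encoded as \<open>k * c + i\<close>. In this encoding the tensor product is strictly
  associative.
\<close>

definition kron :: "complex mat \<Rightarrow> complex mat \<Rightarrow> complex mat" where
  "kron A B = mat (dim_row A * dim_row B) (dim_col A * dim_col B)
     (\<lambda>(p, q). A $$ (p div dim_row B, q div dim_col B) * B $$ (p mod dim_row B, q mod dim_col B))"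

text \<open>
  For \<open>X\<close> in the tensor product of the \<open>a \<times> a\<close> and the \<open>c \<times> c\<close> matrices, \<open>lcoeff a c X i j\<close> and
  \<open>rcoeff a c X i j\<close> are the coefficients in the expansions of \<open>X\<close> along the matrix units of the
  second, respectively the first factor:
  \<open>X = (\<Sum>i j. lcoeff a c X i j \<otimes> e\<^sub>i\<^sub>j) = (\<Sum>i j. e\<^sub>i\<^sub>j \<otimes> rcoeff a c X i j)\<close>.
\<close>

definition lcoeff :: "nat \<Rightarrow> nat \<Rightarrow> complex mat \<Rightarrow> nat \<Rightarrow> nat \<Rightarrow> complex mat" where
  "lcoeff a c X i j = mat a a (\<lambda>(k, l). X $$ (k * c + i, l * c + j))"

definition rcoeff :: "nat \<Rightarrow> nat \<Rightarrow> complex mat \<Rightarrow> nat \<Rightarrow> nat \<Rightarrow> complex mat" where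
  "rcoeff a c X i j = mat c c (\<lambda>(k, l). X $$ (i * c + k, j * c + l))"

text \<open>
  \<open>tensor_id a b c T\<close> is \<open>T \<otimes> \<iota>\<close> for a linear map \<open>T\<close> from the \<open>a \<times> a\<close> to the \<open>b \<times> b\<close> matrices and
  the identity of the \<open>c \<times> c\<close> matrices, i.e. \<open>X \<mapsto> (\<Sum>i j. T (lcoeff a c X i j) \<otimes> e\<^sub>i\<^sub>j)\<close> written
  entrywise. Likewise \<open>id_tensor a b c T\<close> is \<open>\<iota> \<otimes> T\<close> for the identity of the \<open>a \<times> a\<close> matrices and
  \<open>T\<close> from the \<open>b \<times> b\<close> to the \<open>c \<times> c\<close> matrices.
\<close>

definition tensor_id ::
    "nat \<Rightarrow> nat \<Rightarrow> nat \<Rightarrow> (complex mat \<Rightarrow> complex mat) \<Rightarrow> complex mat \<Rightarrow> complex mat" where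
  "tensor_id a b c T X = mat (b * c) (b * c)
     (\<lambda>(p, q). T (lcoeff a c X (p mod c) (q mod c)) $$ (p div c, q div c))"

definition id_tensor ::
    "nat \<Rightarrow> nat \<Rightarrow> nat \<Rightarrow> (complex mat \<Rightarrow> complex mat) \<Rightarrow> complex mat \<Rightarrow> complex mat" where
  "id_tensor a b c T X = mat (a * c) (a * c)
     (\<lambda>(p, q). T (rcoeff a b X (p div c) (q div c)) $$ (p mod c, q mod c))"

definition star_hom :: "nat \<Rightarrow> nat \<Rightarrow> (complex mat \<Rightarrow> complex mat) \<Rightarrow> bool" where
  "star_hom a b T \<longleftrightarrow>
     (\<forall>x \<in> carrier_mat a a. T x \<in> carrier_mat b b) \<and>
     (\<forall>x \<in> carrier_mat a a. \<forall>y \<in> carrier_mat a a. T (x + y) = T x + T y) \<and>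
     (\<forall>c. \<forall>x \<in> carrier_mat a a. T (c \<cdot>\<^sub>m x) = c \<cdot>\<^sub>m T x) \<and>
     (\<forall>x \<in> carrier_mat a a. \<forall>y \<in> carrier_mat a a. T (x * y) = T x * T y) \<and>
     (\<forall>x \<in> carrier_mat a a. T (mat_adjoint x) = mat_adjoint (T x))"

lemma tensor_id_kron:
  assumes T: "star_hom a b T" and A: "A \<in> carrier_mat a a" and B: "B \<in> carrier_mat c c"
  shows "tensor_id a b c T (kron A B) = kron (T A) B"
proof -
  have TA: "T A \<in> carrier_mat b b"
    using T A by (auto simp: star_hom_def)
  have coeff: "lcoeff a c (kron A B) i j = B $$ (i, j) \<cdot>\<^sub>m A" if "i < c" "j < c" for i j
  proof (rule eq_matI)
    fix k l assume "k < dim_row (B $$ (i, j) \<cdot>\<^sub>m A)" "l < dim_col (B $$ (i, j) \<cdot>\<^sub>m A)"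
    then have "k < a" "l < a" using A by auto
    moreover have "k * c + i < a * c" "l * c + j < a * c"
      using \<open>k < a\<close> \<open>l < a\<close> that mult_le_mono1[of "Suc k" a c] mult_le_mono1[of "Suc l" a c]
      by auto
    ultimately show "lcoeff a c (kron A B) i j $$ (k, l) = (B $$ (i, j) \<cdot>\<^sub>m A) $$ (k, l)"
      using A B that by (auto simp: lcoeff_def kron_def)
  qed (use A in \<open>auto simp: lcoeff_def\<close>)
  show ?thesis
  proof (rule eq_matI)
    fix p q assume "p < dim_row (kron (T A) B)" "q < dim_col (kron (T A) B)"
    then have pq: "p < b * c" "q < b * c" using TA B by (auto simp: kron_def)
    then have "c > 0" by (cases c) auto
    have "T (B $$ (p mod c, q mod c) \<cdot>\<^sub>m A) = B $$ (p mod c, q mod c) \<cdot>\<^sub>m T A"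
      using T A by (auto simp: star_hom_def)
    then show "tensor_id a b c T (kron A B) $$ (p, q) = kron (T A) B $$ (p, q)"
      using TA B pq \<open>c > 0\<close>
      by (simp add: tensor_id_def coeff) (auto simp: kron_def less_mult_imp_div_less)
  qed (use TA B in \<open>auto simp: tensor_id_def kron_def\<close>)
qed

lemma id_tensor_kron:
  assumes T: "star_hom b c T" and A: "A \<in> carrier_mat a a" and B: "B \<in> carrier_mat b b"
  shows "id_tensor a b c T (kron A B) = kron A (T B)"
proof -
  have TB: "T B \<in> carrier_mat c c"
    using T B by (auto simp: star_hom_def)
  have coeff: "rcoeff a b (kron A B) i j = A $$ (i, j) \<cdot>\<^sub>m B" if "i < a" "j < a" for i j
  proof (rule eq_matI)
    fix k l assume "k < dim_row (A $$ (i, j) \<cdot>\<^sub>m B)" "l < dim_col (A $$ (i, j) \<cdot>\<^sub>m B)"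
    then have "k < b" "l < b" using B by auto
    moreover have "i * b + k < a * b" "j * b + l < a * b"
      using \<open>k < b\<close> \<open>l < b\<close> that mult_le_mono1[of "Suc i" a b] mult_le_mono1[of "Suc j" a b]
      by auto
    ultimately show "rcoeff a b (kron A B) i j $$ (k, l) = (A $$ (i, j) \<cdot>\<^sub>m B) $$ (k, l)"
      using A B that by (auto simp: rcoeff_def kron_def)
  qed (use B in \<open>auto simp: rcoeff_def\<close>)
  show ?thesis
  proof (rule eq_matI)
    fix p q assume "p < dim_row (kron A (T B))" "q < dim_col (kron A (T B))"
    then have pq: "p < a * c" "q < a * c" using TB A by (auto simp: kron_def)
    then have "c > 0" by (cases c) auto
    have "T (A $$ (p div c, q div c) \<cdot>\<^sub>m B) = A $$ (p div c, q div c) \<cdot>\<^sub>m T B"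
      using T B by (auto simp: star_hom_def)
    then show "id_tensor a b c T (kron A B) $$ (p, q) = kron A (T B) $$ (p, q)"
      using TB A pq \<open>c > 0\<close>
      by (simp add: id_tensor_def coeff less_mult_imp_div_less) (auto simp: kron_def)
  qed (use TB A in \<open>auto simp: id_tensor_def kron_def\<close>)
qed

text \<open>
  The sum of a family of \<open>k \<times> k\<close> matrices over the whole index set. As for \<^const>\<open>Sum_any\<close>, only
  families with finite support are meaningful.
\<close>

definition mat_Sum :: "nat \<Rightarrow> ('i \<Rightarrow> complex mat) \<Rightarrow> complex mat" where
  "mat_Sum k X = mat k k (\<lambda>(p, q). Sum_any (\<lambda>\<omega>. X \<omega> $$ (p, q)))"


subsection \<open>Function algebras\<close>

definition Falg :: "('i \<Rightarrow> nat) \<Rightarrow> ('i \<Rightarrow> complex mat) set" where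
  "Falg n = {f. \<forall>\<gamma>. f \<gamma> \<in> carrier_mat (n \<gamma>) (n \<gamma>)}"

definition Fone :: "('i \<Rightarrow> nat) \<Rightarrow> 'i \<Rightarrow> complex mat" where
  "Fone n = (\<lambda>\<gamma>. 1\<^sub>m (n \<gamma>))"

definition Fsmult :: "complex \<Rightarrow> ('i \<Rightarrow> complex mat) \<Rightarrow> 'i \<Rightarrow> complex mat" where
  "Fsmult c f = (\<lambda>\<gamma>. c \<cdot>\<^sub>m f \<gamma>)"

definition Fadjoint :: "('i \<Rightarrow> complex mat) \<Rightarrow> 'i \<Rightarrow> complex mat" where
  "Fadjoint f = (\<lambda>\<gamma>. mat_adjoint (f \<gamma>))"

definition Fnorm :: "('i \<Rightarrow> complex mat) \<Rightarrow> ennreal" where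
  "Fnorm f = (SUP \<gamma>. ennreal (opnorm (f \<gamma>)))"

definition Fb :: "('i \<Rightarrow> nat) \<Rightarrow> ('i \<Rightarrow> complex mat) set" where
  "Fb n = {f \<in> Falg n. Fnorm f < \<infinity>}"

definition Ftensor ::
    "('i \<Rightarrow> complex mat) \<Rightarrow> ('j \<Rightarrow> complex mat) \<Rightarrow> 'i \<times> 'j \<Rightarrow> complex mat" where
  "Ftensor f g = (\<lambda>(\<alpha>, \<beta>). kron (f \<alpha>) (g \<beta>))"


subsection \<open>Discrete quantum semigroups\<close>

text \<open>
  \<open>D \<alpha> \<beta> \<gamma>\<close> is the component of the comultiplication with upper index \<open>\<alpha>\<close> and lower indices
  \<open>\<beta>, \<gamma>\<close>. By the orthogonality condition (the second conjunct below), for fixed \<open>\<beta>, \<gamma>\<close> only finitely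
  many \<open>D \<alpha> \<beta> \<gamma>\<close> are nonzero, so that all families summed here have finite support.
\<close>

type_synonym 'i comult_family = "'i \<Rightarrow> 'i \<Rightarrow> 'i \<Rightarrow> complex mat \<Rightarrow> complex mat"

definition comultiplication :: "('i \<Rightarrow> nat) \<Rightarrow> 'i comult_family \<Rightarrow> bool" where
  "comultiplication n D \<longleftrightarrow>
     (\<forall>\<alpha> \<beta> \<gamma>. star_hom (n \<alpha>) (n \<beta> * n \<gamma>) (D \<alpha> \<beta> \<gamma>)) \<and>
     (\<forall>\<alpha> \<alpha>' \<beta> \<gamma>. \<alpha> \<noteq> \<alpha>' \<longrightarrow>
        D \<alpha> \<beta> \<gamma> (1\<^sub>m (n \<alpha>)) * D \<alpha>' \<beta> \<gamma> (1\<^sub>m (n \<alpha>')) = 0\<^sub>m (n \<beta> * n \<gamma>) (n \<beta> * n \<gamma>)) \<and>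
     (\<forall>\<kappa> \<alpha> \<beta> \<gamma>. \<forall>x \<in> carrier_mat (n \<kappa>) (n \<kappa>).
        mat_Sum (n \<alpha> * n \<beta> * n \<gamma>)
          (\<lambda>\<omega>. tensor_id (n \<omega>) (n \<alpha> * n \<beta>) (n \<gamma>) (D \<omega> \<alpha> \<beta>) (D \<kappa> \<omega> \<gamma> x)) =
        mat_Sum (n \<alpha> * n \<beta> * n \<gamma>)
          (\<lambda>\<omega>. id_tensor (n \<alpha>) (n \<omega>) (n \<beta> * n \<gamma>) (D \<omega> \<beta> \<gamma>) (D \<kappa> \<alpha> \<omega> x)))"

definition discrete_quantum_semigroup :: "('i \<Rightarrow> nat) \<Rightarrow> 'i comult_family \<Rightarrow> bool" where
  "discrete_quantum_semigroup n D \<longleftrightarrow> index_system n \<and> comultiplication n D"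

definition comult ::
    "('i \<Rightarrow> nat) \<Rightarrow> 'i comult_family \<Rightarrow> ('i \<Rightarrow> complex mat) \<Rightarrow> 'i \<times> 'i \<Rightarrow> complex mat" where
  "comult n D f = (\<lambda>(\<beta>, \<gamma>). mat_Sum (n \<beta> * n \<gamma>) (\<lambda>\<alpha>. D \<alpha> \<beta> \<gamma> (f \<alpha>)))"


subsection \<open>Amenability\<close>

text \<open>A functional on \<^term>\<open>Fb n\<close> is a function whose values off \<^term>\<open>Fb n\<close> are irrelevant.\<close>

definition linear_functional :: "('i \<Rightarrow> nat) \<Rightarrow> (('i \<Rightarrow> complex mat) \<Rightarrow> complex) \<Rightarrow> bool" where
  "linear_functional n m \<longleftrightarrow>
     (\<forall>f \<in> Fb n. \<forall>g \<in> Fb n. m (f + g) = m f + m g) \<and>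
     (\<forall>c. \<forall>f \<in> Fb n. m (Fsmult c f) = c * m f)"

text \<open>In the order on complex numbers used here, \<open>0 \<le> z\<close> means that \<open>z\<close> is real and nonnegative.\<close>

definition state :: "('i \<Rightarrow> nat) \<Rightarrow> (('i \<Rightarrow> complex mat) \<Rightarrow> complex) \<Rightarrow> bool" where
  "state n m \<longleftrightarrow> linear_functional n m \<and>
     (\<forall>f \<in> Fb n. 0 \<le> m (Fadjoint f * f)) \<and> m (Fone n) = 1"

definition slice_left ::
    "('i \<Rightarrow> nat) \<Rightarrow> (('i \<Rightarrow> complex mat) \<Rightarrow> complex) \<Rightarrow> ('i \<times> 'i \<Rightarrow> complex mat) \<Rightarrow> 'i \<Rightarrow> complex mat"
  where
  "slice_left n m g = (\<lambda>\<beta>. mat (n \<beta>) (n \<beta>)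
     (\<lambda>(i, j). m (\<lambda>\<alpha>. lcoeff (n \<alpha>) (n \<beta>) (g (\<alpha>, \<beta>)) i j)))"

definition slice_right ::
    "('i \<Rightarrow> nat) \<Rightarrow> (('i \<Rightarrow> complex mat) \<Rightarrow> complex) \<Rightarrow> ('i \<times> 'i \<Rightarrow> complex mat) \<Rightarrow> 'i \<Rightarrow> complex mat"
  where
  "slice_right n m g = (\<lambda>\<alpha>. mat (n \<alpha>) (n \<alpha>)
     (\<lambda>(i, j). m (\<lambda>\<beta>. rcoeff (n \<alpha>) (n \<beta>) (g (\<alpha>, \<beta>)) i j)))"

definition right_amenable :: "('i \<Rightarrow> nat) \<Rightarrow> 'i comult_family \<Rightarrow> bool" where
  "right_amenable n D \<longleftrightarrow>
     (\<exists>m. state n m \<and> (\<forall>f \<in> Fb n. slice_left n m (comult n D f) = Fsmult (m f) (Fone n)))"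

definition left_amenable :: "('i \<Rightarrow> nat) \<Rightarrow> 'i comult_family \<Rightarrow> bool" where
  "left_amenable n D \<longleftrightarrow>
     (\<exists>m. state n m \<and> (\<forall>f \<in> Fb n. slice_right n m (comult n D f) = Fsmult (m f) (Fone n)))"

end

theory Submission
  imports Defs
begin

text \<open>
  If \<open>\<Delta>(f) - 1 \<otimes> f - f \<otimes> 1 = g\<close> is bounded and \<open>m\<close> is a right invariant mean, then
  \<open>F = f + (m \<otimes> \<iota>)(g)\<close> is the required additive function: coassociativity gives the cocycle identity
  \<open>(\<iota> \<otimes> \<Delta>)(g) + 1 \<otimes> g = (\<Delta> \<otimes> \<iota>)(g) + g \<otimes> 1\<close>, and \<open>m\<close> is applied to its first leg. The identity
  needs \<open>\<Delta>(1) = 1 \<otimes> 1\<close>, which is not part of the definition of a comultiplication but follows from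
  the existence of the mean. Since states are contractive, \<open>\<parallel>F - f\<parallel> \<le> \<parallel>g\<parallel>\<close>, so \<open>r' = r\<close> works.
  The left amenable case is the same argument for the opposite comultiplication; it becomes literally
  the same once functions are expressed through their matrix entries, where \<open>\<Delta>\<close> is given by
  structure constants and passing to the opposite just swaps two arguments.
\<close>

section \<open>Sesquilinear forms and the operator norm\<close>

text \<open>The mean acts on bounded functions only, while \<open>f\<close> itself may be unbounded.
  It is therefore applied only to functions built from the unit and the defect g; the cocycle
  identity serves to remove every bare occurrence of \<open>f\<close> before the mean acts.
  Contractivity has to be extracted from positivity, which a state has only on products f^* f. For
  \<phi> bounded by C one must write C^2 - \<phi>^* \<phi> as K^* K with K again a bounded function.
  Cholesky elimination gives such a K at every index, and the identity itself forces the bound C on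
  each of them, uniformly in the index. A bound on scalar means does not directly bound the matrix
  (m \<otimes> \<iota>)(g)(\<beta>). Paired with vectors z, w, this matrix becomes the mean of the
  vector slice of g by z and w, whose norm is at most C times the norms of z and w, so ordinary
  contractivity suffices. For this reason operator norms are handled through sesquilinear forms. The
  sums defining \<Delta> are finite because there are at most N mutually orthogonal nonzero
  projections of size N, each having trace at least 1.\<close>

definition l2 :: "nat \<Rightarrow> (nat \<Rightarrow> complex) \<Rightarrow> real" where
  "l2 N x = L2_set (\<lambda>i. cmod (x i)) {..<N}"

definition mat_apply :: "nat \<Rightarrow> (nat \<Rightarrow> nat \<Rightarrow> complex) \<Rightarrow> (nat \<Rightarrow> complex) \<Rightarrow> nat \<Rightarrow> complex" where
  "mat_apply N A x i = (\<Sum>j<N. A i j * x j)"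

definition sesq ::
    "nat \<Rightarrow> (nat \<Rightarrow> nat \<Rightarrow> complex) \<Rightarrow> (nat \<Rightarrow> complex) \<Rightarrow> (nat \<Rightarrow> complex) \<Rightarrow> complex" where
  "sesq N A y x = (\<Sum>i<N. \<Sum>j<N. cnj (y i) * A i j * x j)"

text \<open>The bound is phrased through the form and not as a supremum, so that sums, adjoints and
  slices of tensor products reduce to identities between forms.\<close>

definition op_bounded :: "nat \<Rightarrow> (nat \<Rightarrow> nat \<Rightarrow> complex) \<Rightarrow> real \<Rightarrow> bool" where
  "op_bounded N A C \<longleftrightarrow> 0 \<le> C \<and> (\<forall>x y. cmod (sesq N A y x) \<le> C * l2 N y * l2 N x)"

text \<open>The matrix A^* A; on elements of this shape a state is nonnegative by
  definition.\<close>

definition gram :: "nat \<Rightarrow> (nat \<Rightarrow> nat \<Rightarrow> complex) \<Rightarrow> nat \<Rightarrow> nat \<Rightarrow> complex" where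
  "gram N A i j = (\<Sum>k<N. cnj (A k i) * A k j)"

lemma l2_nonneg [simp]: "0 \<le> l2 N x"
  by (simp add: l2_def L2_set_nonneg)

lemma l2_power2: "(l2 N x)\<^sup>2 = (\<Sum>i<N. (cmod (x i))\<^sup>2)"
  by (simp add: l2_def L2_set_def sum_nonneg)

lemma l2_power2_complex: "complex_of_real ((l2 N x)\<^sup>2) = (\<Sum>i<N. cnj (x i) * x i)"
  unfolding l2_power2 of_real_sum
  by (rule sum.cong[OF refl]) (simp only: complex_norm_square mult.commute)

lemma l2_cong: "(\<And>i. i < N \<Longrightarrow> x i = y i) \<Longrightarrow> l2 N x = l2 N y"
  unfolding l2_def by (rule L2_set_cong) auto

lemma sesq_cong:
  "(\<And>i j. i < N \<Longrightarrow> j < N \<Longrightarrow> A i j = B i j) \<Longrightarrow> sesq N A = sesq N B"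
  unfolding sesq_def by (intro ext sum.cong) auto

lemma op_bounded_cong:
  "(\<And>i j. i < N \<Longrightarrow> j < N \<Longrightarrow> A i j = B i j) \<Longrightarrow> op_bounded N A C = op_bounded N B C"
  unfolding op_bounded_def by (subst sesq_cong[of N A B]) auto

lemma op_bounded_nonneg: "op_bounded N A C \<Longrightarrow> 0 \<le> C"
  by (simp add: op_bounded_def)

lemma l2_Cauchy_Schwarz: "cmod (\<Sum>i<N. cnj (y i) * x i) \<le> l2 N y * l2 N x"
proof -
  have "cmod (\<Sum>i<N. cnj (y i) * x i) \<le> (\<Sum>i<N. \<bar>cmod (y i)\<bar> * \<bar>cmod (x i)\<bar>)"
    by (rule sum_norm_le) (simp add: norm_mult)
  also have "\<dots> \<le> l2 N y * l2 N x"
    unfolding l2_def by (rule L2_set_mult_ineq)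
  finally show ?thesis .
qed

lemma sesq_mat_apply: "sesq N A y x = (\<Sum>i<N. cnj (y i) * mat_apply N A x i)"
  by (simp add: sesq_def mat_apply_def sum_distrib_left mult.assoc)

text \<open>One direction tests the form at y = Ax and cancels one factor of the norm of Ax; the
  other is Cauchy-Schwarz.\<close>

lemma op_bounded_iff_mat_apply: "op_bounded N A C \<longleftrightarrow> 0 \<le> C \<and> (\<forall>x. l2 N (mat_apply N A x) \<le> C * l2 N x)"
proof (intro iffI conjI allI)
  assume A: "op_bounded N A C"
  show "0 \<le> C" using A by (simp add: op_bounded_def)
  fix x
  let ?y = "mat_apply N A x"
  have "(l2 N ?y)\<^sup>2 = cmod (sesq N A ?y x)"
    unfolding sesq_mat_apply l2_power2_complex[symmetric] norm_of_real by simp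
  also have "\<dots> \<le> C * l2 N ?y * l2 N x"
    using A by (simp add: op_bounded_def)
  finally have "l2 N ?y * l2 N ?y \<le> l2 N ?y * (C * l2 N x)"
    by (simp add: power2_eq_square mult_ac)
  then show "l2 N ?y \<le> C * l2 N x"
    using \<open>0 \<le> C\<close> by (cases "l2 N ?y = 0") (auto simp: mult_le_cancel_left not_less less_le)
next
  assume A: "0 \<le> C \<and> (\<forall>x. l2 N (mat_apply N A x) \<le> C * l2 N x)"
  show "op_bounded N A C"
    unfolding op_bounded_def
  proof (intro conjI allI)
    fix x y
    have "cmod (sesq N A y x) \<le> l2 N y * l2 N (mat_apply N A x)"
      unfolding sesq_mat_apply by (rule l2_Cauchy_Schwarz)
    also have "\<dots> \<le> l2 N y * (C * l2 N x)"
      using A by (intro mult_left_mono) auto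
    finally show "cmod (sesq N A y x) \<le> C * l2 N y * l2 N x"
      by (simp add: mult_ac)
  qed (use A in auto)
qed

lemma op_bounded_add: 
  assumes "op_bounded N A C" "op_bounded N B C'"
  shows "op_bounded N (\<lambda>i j. A i j + B i j) (C + C')"
  unfolding op_bounded_def
proof (intro conjI allI)
  fix x y
  have "sesq N (\<lambda>i j. A i j + B i j) y x = sesq N A y x + sesq N B y x"
    by (simp add: sesq_def algebra_simps sum.distrib)
  then have "cmod (sesq N (\<lambda>i j. A i j + B i j) y x) \<le> cmod (sesq N A y x) + cmod (sesq N B y x)"
    by (simp add: norm_triangle_ineq)
  also have "\<dots> \<le> C * l2 N y * l2 N x + C' * l2 N y * l2 N x"
    using assms by (intro add_mono) (auto simp: op_bounded_def)
  finally show "cmod (sesq N (\<lambda>i j. A i j + B i j) y x) \<le> (C + C') * l2 N y * l2 N x"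
    by (simp add: algebra_simps)
qed (use assms in \<open>auto simp: op_bounded_def\<close>)

lemma op_bounded_scale:
  assumes "op_bounded N A C"
  shows "op_bounded N (\<lambda>i j. c * A i j) (cmod c * C)"
  unfolding op_bounded_def
proof (intro conjI allI)
  fix x y
  have "sesq N (\<lambda>i j. c * A i j) y x = c * sesq N A y x"
    by (simp add: sesq_def sum_distrib_left mult_ac)
  then show "cmod (sesq N (\<lambda>i j. c * A i j) y x) \<le> cmod c * C * l2 N y * l2 N x"
    using assms by (auto simp: op_bounded_def norm_mult mult.assoc intro: mult_left_mono)
qed (use assms in \<open>auto simp: op_bounded_def\<close>)

lemma op_bounded_id: "op_bounded N (\<lambda>i j. if i = j then 1 else 0) 1"
proof -
  have "l2 N (mat_apply N (\<lambda>i j. if i = j then 1 else 0) x) = l2 N x" for x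
    by (rule l2_cong) (simp add: mat_apply_def if_distribR if_distrib[of "\<lambda>c. c * _"] cong: if_cong)
  then show ?thesis
    by (simp add: op_bounded_iff_mat_apply)
qed

lemma op_bounded_adjoint:
  assumes "op_bounded N A C"
  shows "op_bounded N (\<lambda>i j. cnj (A j i)) C"
  unfolding op_bounded_def
proof (intro conjI allI)
  fix x y
  have "sesq N (\<lambda>i j. cnj (A j i)) y x = cnj (sesq N A x y)"
    unfolding sesq_def by (subst sum.swap) (simp add: mult_ac)
  then show "cmod (sesq N (\<lambda>i j. cnj (A j i)) y x) \<le> C * l2 N y * l2 N x"
    using assms[unfolded op_bounded_def, THEN conjunct2, rule_format, of x y] by (simp add: mult_ac)
qed (use assms in \<open>auto simp: op_bounded_def\<close>)

lemma sesq_gram: "sesq N (gram N A) x x = complex_of_real ((l2 N (mat_apply N A x))\<^sup>2)"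
proof -
  have "sesq N (gram N A) x x = (\<Sum>i<N. \<Sum>j<N. \<Sum>k<N. cnj (A k i * x i) * (A k j * x j))"
    by (simp add: sesq_def gram_def sum_distrib_left sum_distrib_right mult_ac)
  also have "\<dots> = (\<Sum>i<N. \<Sum>k<N. \<Sum>j<N. cnj (A k i * x i) * (A k j * x j))"
    by (intro sum.cong refl sum.swap)
  also have "\<dots> = (\<Sum>k<N. \<Sum>i<N. \<Sum>j<N. cnj (A k i * x i) * (A k j * x j))"
    by (rule sum.swap)
  also have "\<dots> = (\<Sum>k<N. cnj (mat_apply N A x k) * mat_apply N A x k)"
    by (simp add: mat_apply_def sum_product)
  finally show ?thesis
    unfolding l2_power2_complex .
qed

lemma op_bounded_gram:
  assumes "op_bounded N A C"
  shows "op_bounded N (gram N A) (C * C)"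
  unfolding op_bounded_iff_mat_apply
proof (intro conjI allI)
  fix x
  have eq: "mat_apply N (gram N A) x i = mat_apply N (\<lambda>i j. cnj (A j i)) (mat_apply N A x) i" for i
    unfolding mat_apply_def gram_def sum_distrib_left sum_distrib_right
    by (subst sum.swap) (simp add: mult_ac)
  have "l2 N (mat_apply N (\<lambda>i j. cnj (A j i)) (mat_apply N A x)) \<le> C * l2 N (mat_apply N A x)"
    using op_bounded_adjoint[OF assms] by (simp add: op_bounded_iff_mat_apply)
  also have "\<dots> \<le> C * (C * l2 N x)"
    using assms by (intro mult_left_mono) (auto simp: op_bounded_iff_mat_apply)
  finally show "l2 N (mat_apply N (gram N A) x) \<le> C * C * l2 N x"
    by (simp add: eq[abs_def] mult.assoc)
qed simp

text \<open>A^* A = A says that A is an orthogonal projection. The squared norm of Ax is then the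
  form at x, x, which Cauchy-Schwarz bounds by the norm of x times that of Ax.\<close>

lemma op_bounded_projection:
  assumes "\<And>i j. i < N \<Longrightarrow> j < N \<Longrightarrow> gram N A i j = A i j"
  shows "op_bounded N A 1"
  unfolding op_bounded_iff_mat_apply
proof (intro conjI allI)
  fix x
  have "complex_of_real ((l2 N (mat_apply N A x))\<^sup>2) = sesq N A x x"
    unfolding sesq_gram[symmetric] using sesq_cong[of N "gram N A" A] assms by simp
  then have "(l2 N (mat_apply N A x))\<^sup>2 = cmod (sesq N A x x)"
    by (metis norm_of_real abs_power2)
  also have "\<dots> \<le> l2 N x * l2 N (mat_apply N A x)"
    unfolding sesq_mat_apply by (rule l2_Cauchy_Schwarz)
  finally have "l2 N (mat_apply N A x) * l2 N (mat_apply N A x) \<le> l2 N (mat_apply N A x) * l2 N x"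
    by (simp add: power2_eq_square mult_ac)
  then show "l2 N (mat_apply N A x) \<le> 1 * l2 N x"
    by (cases "l2 N (mat_apply N A x) = 0") (auto simp: mult_le_cancel_left not_less less_le)
qed simp

text \<open>The crude bound by the sum of the moduli of all entries. It shows that the set whose
  supremum is \<open>opnorm\<close> is bounded above.\<close>

lemma op_bounded_exists: "\<exists>C. op_bounded N A C"
proof -
  have le: "cmod (x i) \<le> l2 N x" if "i < N" for x i
    using that member_le_L2_set[of "{..<N}" i "\<lambda>i. cmod (x i)"] by (simp add: l2_def)
  then have *: "cmod (sesq N A y x) \<le> (\<Sum>i<N. \<Sum>j<N. cmod (A i j)) * l2 N y * l2 N x" for x y
    unfolding sesq_def sum_distrib_right
  proof (intro sum_norm_le)
    fix i j assume "i \<in> {..<N}" "j \<in> {..<N}"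
    then have "cmod (y i) \<le> l2 N y" "cmod (x j) \<le> l2 N x" using le by auto
    then have "cmod (y i) * cmod (x j) \<le> l2 N y * l2 N x"
      by (intro mult_mono) auto
    from mult_left_mono[OF this, of "cmod (A i j)"]
    show "cmod (cnj (y i) * A i j * x j) \<le> cmod (A i j) * l2 N y * l2 N x"
      by (simp add: norm_mult mult_ac)
  qed
  then show ?thesis
    unfolding op_bounded_def by (intro exI[of _ "\<Sum>i<N. \<Sum>j<N. cmod (A i j)"]) (auto intro!: sum_nonneg)
qed

section \<open>Comparison with the operator norm as a supremum over the unit ball\<close>

lemma l2_scale: "l2 N (\<lambda>i. c * x i) = cmod c * l2 N x"
  by (simp add: l2_def norm_mult L2_set_right_distrib)

lemma mat_apply_scale: "mat_apply N A (\<lambda>i. c * x i) = (\<lambda>i. c * mat_apply N A x i)"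
  by (simp add: fun_eq_iff mat_apply_def sum_distrib_left mult_ac)

lemma op_bounded_unit_ball:
  assumes "op_bounded N A C" "l2 N x \<le> 1"
  shows "l2 N (mat_apply N A x) \<le> C"
proof -
  have "l2 N (mat_apply N A x) \<le> C * l2 N x" using assms by (simp add: op_bounded_iff_mat_apply)
  also have "\<dots> \<le> C * 1"
    by (rule mult_left_mono[OF assms(2) op_bounded_nonneg[OF assms(1)]])
  finally show ?thesis by simp
qed

lemma opnorm_mat: "opnorm (mat N N (\<lambda>(i, j). A i j)) = Sup {l2 N (mat_apply N A x) |x. l2 N x \<le> 1}"
proof -
  have 1: "vec_l2norm v = l2 N (\<lambda>i. v $ i)" if "v \<in> carrier_vec N" for v
    using that by (simp add: vec_l2norm_def l2_def)
  have 2: "vec_l2norm (mat N N (\<lambda>(i, j). A i j) *\<^sub>v v) = l2 N (mat_apply N A (\<lambda>i. v $ i))"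
    if "v \<in> carrier_vec N" for v
    using that by (auto simp: vec_l2norm_def l2_def mat_apply_def scalar_prod_def lessThan_atLeast0
        intro!: L2_set_cong)
  have 3: "l2 N (\<lambda>i. vec N x $ i) = l2 N x" "mat_apply N A (\<lambda>i. vec N x $ i) = mat_apply N A x" for x
    by (auto intro!: l2_cong sum.cong simp: mat_apply_def)
  have "{vec_l2norm (mat N N (\<lambda>(i, j). A i j) *\<^sub>v v) |v.
      v \<in> carrier_vec N \<and> vec_l2norm v \<le> 1} = {l2 N (mat_apply N A x) |x. l2 N x \<le> 1}"
    (is "?S = ?T")
  proof
    show "?S \<subseteq> ?T" using 1 2 by auto
    show "?T \<subseteq> ?S"
    proof
      fix s assume "s \<in> ?T"
      then obtain x where "l2 N x \<le> 1" "s = l2 N (mat_apply N A x)" by auto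
      then show "s \<in> ?S"
        using 1[of "vec N x"] 2[of "vec N x"] by (auto simp: 3 intro!: exI[of _ "vec N x"])
    qed
  qed
  then show ?thesis by (simp add: opnorm_def)
qed

lemma bdd_above_unit_ball: "bdd_above {l2 N (mat_apply N A x) |x. l2 N x \<le> 1}"
proof -
  obtain K where "op_bounded N A K" using op_bounded_exists by blast
  then show ?thesis using op_bounded_unit_ball by (intro bdd_aboveI[of _ K]) blast
qed

lemma opnorm_mat_le_iff:
  assumes "0 \<le> C"
  shows "opnorm (mat N N (\<lambda>(i, j). A i j)) \<le> C \<longleftrightarrow> op_bounded N A C"
proof
  assume "op_bounded N A C"
  then show "opnorm (mat N N (\<lambda>(i, j). A i j)) \<le> C"
    unfolding opnorm_mat using op_bounded_unit_ball
    by (intro cSup_least) (auto intro!: exI[of _ "\<lambda>_. 0"] simp: l2_def L2_set_def)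
next
  assume H: "opnorm (mat N N (\<lambda>(i, j). A i j)) \<le> C"
  have le: "l2 N (mat_apply N A x) \<le> C" if "l2 N x \<le> 1" for x
  proof -
    have "l2 N (mat_apply N A x) \<le> Sup {l2 N (mat_apply N A x) |x. l2 N x \<le> 1}"
      by (rule cSup_upper[OF _ bdd_above_unit_ball]) (use that in auto)
    with H show ?thesis by (simp add: opnorm_mat)
  qed
  have "l2 N (mat_apply N A x) \<le> C * l2 N x" for x
  proof (cases "l2 N x = 0")
    case True
    \<comment> \<open>A vector of norm 0 cannot be normalised; any bound \<open>K\<close> shows that
      its image also has norm 0.\<close>
    obtain K where "op_bounded N A K" using op_bounded_exists by blast
    then have "l2 N (mat_apply N A x) \<le> K * l2 N x" by (simp add: op_bounded_iff_mat_apply)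
    then show ?thesis using True by simp
  next
    case False
    then have pos: "l2 N x > 0" using l2_nonneg[of N x] by linarith
    define c where "c = complex_of_real (1 / l2 N x)"
    have c: "cmod c = 1 / l2 N x" using pos by (simp add: c_def norm_divide)
    have "l2 N (\<lambda>i. c * x i) \<le> 1" using pos by (simp add: l2_scale c)
    from le[OF this] show ?thesis using pos by (simp add: mat_apply_scale l2_scale c field_simps)
  qed
  then show "op_bounded N A C" using assms by (simp add: op_bounded_iff_mat_apply)
qed

section \<open>Slices of tensor products\<close>

lemma sum_kron_index:
  fixes f :: "nat \<Rightarrow> 'a::comm_monoid_add"
  shows "(\<Sum>p<a * c. f p) = (\<Sum>s<a. \<Sum>k<c. f (s * c + k))"
proof (induction a)
  case (Suc a)
  have "(\<Sum>p<Suc a * c. f p) = (\<Sum>p\<in>{0..<a * c}. f p) + (\<Sum>p\<in>{a * c..<a * c + c}. f p)"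
    unfolding lessThan_atLeast0 by (subst sum.atLeastLessThan_concat) (auto simp: add.commute)
  also have "(\<Sum>p\<in>{a * c..<a * c + c}. f p) = (\<Sum>k<c. f (a * c + k))"
    using sum.shift_bounds_nat_ivl[of f 0 "a * c" c] by (simp add: lessThan_atLeast0 add.commute)
  finally show ?case using Suc by (simp add: lessThan_atLeast0)
qed simp

lemma l2_kron: "l2 (a * c) (\<lambda>p. y (p div c) * z (p mod c)) = l2 a y * l2 c z"
proof -
  have "(l2 (a * c) (\<lambda>p. y (p div c) * z (p mod c)))\<^sup>2 = (l2 a y * l2 c z)\<^sup>2"
    unfolding power_mult_distrib l2_power2 sum_kron_index sum_product
    by (intro sum.cong) (auto simp: norm_mult power_mult_distrib)
  then show ?thesis by simp
qed

text \<open>The sum is the form of X at the product vectors y \<otimes> z and x \<otimes> w, whose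
  norms multiply by \<open>l2_kron\<close>.\<close>

lemma kron_sesq_bound:
  assumes "op_bounded (a * c) X C"
  shows "cmod (\<Sum>s<a. \<Sum>k<c. \<Sum>t<a. \<Sum>l<c.
            cnj (y s * z k) * X (s * c + k) (t * c + l) * (x t * w l))
    \<le> C * (l2 a y * l2 c z) * (l2 a x * l2 c w)"
proof -
  have "sesq (a * c) X (\<lambda>p. y (p div c) * z (p mod c)) (\<lambda>p. x (p div c) * w (p mod c)) =
      (\<Sum>s<a. \<Sum>k<c. \<Sum>t<a. \<Sum>l<c.
            cnj (y s * z k) * X (s * c + k) (t * c + l) * (x t * w l))"
    unfolding sesq_def sum_kron_index by (intro sum.cong) auto
  moreover have "cmod (sesq (a * c) X (\<lambda>p. y (p div c) * z (p mod c)) (\<lambda>p. x (p div c) * w (p mod c)))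
      \<le> C * (l2 a y * l2 c z) * (l2 a x * l2 c w)"
    using assms unfolding op_bounded_def l2_kron[symmetric] by blast
  ultimately show ?thesis by simp
qed

text \<open>This is X with the vector functional given by z and w applied to its second leg; the
  norms of z and w are the price of the functional.\<close>

lemma op_bounded_slice_left:
  assumes "op_bounded (a * c) X C"
  shows "op_bounded a (\<lambda>s t. \<Sum>k<c. \<Sum>l<c. cnj (z k) * w l * X (s * c + k) (t * c + l))
    (C * l2 c z * l2 c w)"
  unfolding op_bounded_def
proof (intro conjI allI)
  show "0 \<le> C * l2 c z * l2 c w" using assms by (simp add: op_bounded_def)
  fix x y
  let ?f = "\<lambda>s k t l. cnj (y s * z k) * X (s * c + k) (t * c + l) * (x t * w l)"
  have "sesq a (\<lambda>s t. \<Sum>k<c. \<Sum>l<c. cnj (z k) * w l * X (s * c + k) (t * c + l)) y x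
    = (\<Sum>s<a. \<Sum>t<a. \<Sum>k<c. \<Sum>l<c. ?f s k t l)"
    unfolding sesq_def sum_distrib_left sum_distrib_right by (intro sum.cong refl) simp
  also have "\<dots> = (\<Sum>s<a. \<Sum>k<c. \<Sum>t<a. \<Sum>l<c. ?f s k t l)"
    by (intro sum.cong refl sum.swap)
  finally show "cmod (sesq a (\<lambda>s t. \<Sum>k<c. \<Sum>l<c. cnj (z k) * w l * X (s * c + k) (t * c + l)) y x)
    \<le> C * l2 c z * l2 c w * l2 a y * l2 a x"
    using kron_sesq_bound[OF assms, of y z x w] by (simp add: mult_ac)
qed

lemma op_bounded_slice_right:
  assumes "op_bounded (a * c) X C"
  shows "op_bounded c (\<lambda>k l. \<Sum>s<a. \<Sum>t<a. cnj (y s) * x t * X (s * c + k) (t * c + l))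
    (C * l2 a y * l2 a x)"
  unfolding op_bounded_def
proof (intro conjI allI)
  show "0 \<le> C * l2 a y * l2 a x" using assms by (simp add: op_bounded_def)
  fix w z
  let ?f = "\<lambda>s k t l. cnj (y s * z k) * X (s * c + k) (t * c + l) * (x t * w l)"
  have "sesq c (\<lambda>k l. \<Sum>s<a. \<Sum>t<a. cnj (y s) * x t * X (s * c + k) (t * c + l)) z w
    = (\<Sum>k<c. \<Sum>l<c. \<Sum>s<a. \<Sum>t<a. ?f s k t l)"
    unfolding sesq_def sum_distrib_left sum_distrib_right by (intro sum.cong refl) simp
  also have "\<dots> = (\<Sum>k<c. \<Sum>s<a. \<Sum>l<c. \<Sum>t<a. ?f s k t l)"
    by (intro sum.cong refl sum.swap)
  also have "\<dots> = (\<Sum>k<c. \<Sum>s<a. \<Sum>t<a. \<Sum>l<c. ?f s k t l)"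
    by (intro sum.cong refl sum.swap)
  also have "\<dots> = (\<Sum>s<a. \<Sum>k<c. \<Sum>t<a. \<Sum>l<c. ?f s k t l)"
    by (rule sum.swap)
  finally show "cmod (sesq c (\<lambda>k l. \<Sum>s<a. \<Sum>t<a. cnj (y s) * x t * X (s * c + k) (t * c + l)) z w)
    \<le> C * l2 a y * l2 a x * l2 c z * l2 c w"
    using kron_sesq_bound[OF assms, of y z x w] by (simp add: mult_ac)
qed

lemma l2_unit: "i < N \<Longrightarrow> l2 N (\<lambda>k. if k = i then 1 else 0) = 1"
  by (simp add: l2_def L2_set_def if_distrib[of cmod] if_distrib[of "\<lambda>x. x ^ 2"] cong: if_cong)

lemma op_bounded_lcoeff:
  assumes "op_bounded (a * c) X C" "k < c" "l < c"
  shows "op_bounded a (\<lambda>s t. X (s * c + k) (t * c + l)) C"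
proof -
  let ?u = "\<lambda>k i. if i = k then 1 else 0 :: complex"
  have "(\<Sum>k'<c. \<Sum>l'<c. cnj (?u k k') * ?u l l' * X (s * c + k') (t * c + l')) =
      (\<Sum>k'<c. if k' = k then X (s * c + k) (t * c + l) else 0)" for s t
    using assms(3) by (intro sum.cong) (auto simp: if_distrib[of "\<lambda>x. x * _"] cong: if_cong)
  then show ?thesis
    using op_bounded_slice_left[OF assms(1), of "?u k" "?u l"] assms(2,3) by (simp add: l2_unit)
qed

lemma op_bounded_rcoeff:
  assumes "op_bounded (a * c) X C" "s < a" "t < a"
  shows "op_bounded c (\<lambda>k l. X (s * c + k) (t * c + l)) C"
proof -
  let ?u = "\<lambda>k i. if i = k then 1 else 0 :: complex"
  have "(\<Sum>s'<a. \<Sum>t'<a. cnj (?u s s') * ?u t t' * X (s' * c + k) (t' * c + l)) =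
      (\<Sum>s'<a. if s' = s then X (s * c + k) (t * c + l) else 0)" for k l
    using assms(3) by (intro sum.cong) (auto simp: if_distrib[of "\<lambda>x. x * _"] cong: if_cong)
  then show ?thesis
    using op_bounded_slice_right[OF assms(1), of "?u s" "?u t"] assms(2,3) by (simp add: l2_unit)
qed

text \<open>Hermitian symmetry makes the form real at equal arguments, so constraining its real part
  is the usual positivity.\<close>

definition psd :: "nat \<Rightarrow> (nat \<Rightarrow> nat \<Rightarrow> complex) \<Rightarrow> bool" where
  "psd N M \<longleftrightarrow> (\<forall>i<N. \<forall>j<N. M j i = cnj (M i j)) \<and> (\<forall>x. 0 \<le> Re (sesq N M x x))"

section \<open>Cholesky decomposition of positive semidefinite matrices\<close>

lemma cnj_mult_self: "cnj z * z = (complex_of_real (cmod z))\<^sup>2" "z * cnj z = (complex_of_real (cmod z))\<^sup>2"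
  using complex_norm_square[of z] by (simp_all add: mult.commute)

text \<open>Quadratic expansion of the form along a line in the direction of the p-th basis vector.
  Both pivot cases of the elimination consist in a good choice of t.\<close>

lemma sesq_line:
  assumes p: "p < N" and M: "psd N M"
  shows "Re (sesq N M (\<lambda>i. x i + (if i = p then t else 0)) (\<lambda>i. x i + (if i = p then t else 0)))
    = Re (sesq N M x x) + 2 * Re (cnj t * mat_apply N M x p) + (cmod t)\<^sup>2 * Re (M p p)"
proof -
  let ?e = "\<lambda>i. if i = p then t else 0"
  have pick: "(\<Sum>i<N. ?e i * f i) = t * f p" "(\<Sum>i<N. cnj (?e i) * f i) = cnj t * f p" for f
    using p by (simp_all add: if_distrib[of "\<lambda>x. x * _"] if_distrib[of cnj] cong: if_cong)
  have 1: "sesq N M ?e y = cnj t * mat_apply N M y p" for y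
    unfolding sesq_mat_apply pick ..
  have herm: "cnj (M i j) = M j i" if "i < N" "j < N" for i j
    using M that unfolding psd_def by metis
  have adj: "sesq N M y z = cnj (sesq N M z y)" for y z
    unfolding sesq_def by (subst sum.swap) (simp add: herm mult_ac)
  have 2: "mat_apply N M ?e p = t * M p p"
    unfolding mat_apply_def using pick(1)[of "\<lambda>j. M p j"] by (simp add: mult_ac)
  have "sesq N M (\<lambda>i. x i + ?e i) (\<lambda>i. x i + ?e i) =
      sesq N M x x + sesq N M x ?e + sesq N M ?e x + sesq N M ?e ?e"
    unfolding sesq_def by (simp add: algebra_simps sum.distrib)
  then have "Re (sesq N M (\<lambda>i. x i + ?e i) (\<lambda>i. x i + ?e i)) =
      Re (sesq N M x x) + 2 * Re (cnj t * mat_apply N M x p) + Re (cnj t * (t * M p p))"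
    unfolding adj[of x ?e] 1 2 by (simp add: algebra_simps)
  moreover have "cnj t * (t * M p p) = of_real ((cmod t)\<^sup>2) * M p p"
    by (simp add: cnj_mult_self flip: mult.assoc)
  ultimately show ?thesis by simp
qed

text \<open>With a zero diagonal entry the expansion in \<open>sesq_line\<close> has no quadratic
  term, so a nonzero linear term would make the form negative somewhere.\<close>

lemma psd_row_zero:
  assumes p: "p < N" and M: "psd N M" and 0: "M p p = 0" and j: "j < N"
  shows "M p j = 0"
proof (rule ccontr)
  assume nz: "M p j \<noteq> 0"
  let ?u = "\<lambda>i. if i = j then 1 else 0 :: complex"
  have u: "mat_apply N M ?u p = M p j"
    using j by (simp add: mat_apply_def if_distrib[of "\<lambda>x. _ * x"] cong: if_cong)
  define b where "b = Re (sesq N M ?u ?u)"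
  define q where "q = (cmod (M p j))\<^sup>2"
  have q: "q > 0" using nz by (simp add: q_def)
  \<comment> \<open>Chosen so that the linear term becomes -2(b + 1), which outweighs b \<ge>
    0.\<close>
  define t where "t = - complex_of_real ((b + 1) / q) * M p j"
  have "0 \<le> b + 2 * Re (cnj t * M p j) + (cmod t)\<^sup>2 * Re (M p p)"
    unfolding b_def u[symmetric] sesq_line[OF p M, symmetric] using M by (simp add: psd_def)
  moreover have "cnj t * M p j = - complex_of_real ((b + 1) / q * q)"
    unfolding t_def q_def of_real_mult complex_norm_square by (simp add: mult_ac)
  moreover have "(b + 1) / q * q = b + 1" using q by simp
  ultimately have "0 \<le> b - 2 * (b + 1)"
    using 0 by simp
  moreover have "b \<ge> 0" using M by (simp add: psd_def b_def)
  ultimately show False by simp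
qed

lemma psd_diag_nonneg:
  assumes "psd N M" "p < N"
  obtains d where "0 \<le> d" "M p p = complex_of_real d"
proof
  let ?u = "\<lambda>i. if i = p then 1 else 0 :: complex"
  have "sesq N M ?u ?u = M p p"
    using assms by (simp add: sesq_def if_distrib[of "\<lambda>x. x * _"] if_distrib[of "\<lambda>x. _ * x"]
        if_distrib[of cnj] cong: if_cong)
  moreover have "0 \<le> Re (sesq N M ?u ?u)" using assms unfolding psd_def by blast
  ultimately show "0 \<le> Re (M p p)" by simp
  have "M p p = cnj (M p p)" using assms unfolding psd_def by blast
  then show "M p p = complex_of_real (Re (M p p))"
    by (metis Reals_cnj_iff of_real_Re)
qed

text \<open>Cholesky elimination: the rows of index below \<open>p\<close> have already been cleared.\<close>

lemma psd_imp_gram_aux: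
  assumes "p \<le> N" "psd N M" "\<And>i j. i < p \<Longrightarrow> j < N \<Longrightarrow> M i j = 0"
  shows "\<exists>K. (\<forall>i<N. \<forall>j<N. gram N K i j = M i j) \<and> (\<forall>k<p. \<forall>i. K k i = 0)"
  using assms
proof (induction "N - p" arbitrary: p M)
  case 0
  then have "gram N (\<lambda>_ _. 0) i j = M i j" if "i < N" "j < N" for i j
    using that by (simp add: gram_def)
  then show ?case by blast
next
  case (Suc d)
  then have p: "p < N" and d: "d = N - Suc p" by simp_all
  obtain \<mu> where \<mu>: "0 \<le> \<mu>" "M p p = complex_of_real \<mu>"
    using psd_diag_nonneg[OF \<open>psd N M\<close> p] .
  show ?case
  proof (cases "\<mu> = 0")
    case True
    have "M i j = 0" if "i < Suc p" "j < N" for i j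
      using that Suc.prems(3) psd_row_zero[OF p \<open>psd N M\<close>] True \<mu> by (auto simp: less_Suc_eq)
    then obtain K
      where "\<forall>i<N. \<forall>j<N. gram N K i j = M i j" "\<forall>k<Suc p. \<forall>i. K k i = 0"
      using Suc.hyps(1)[OF d _ \<open>psd N M\<close>] p by auto
    then show ?thesis by (intro exI[of _ K]) auto
  next
    case False
    with \<mu> have pos: "\<mu> > 0" by simp
    \<comment> \<open>\<open>w\<close> is the new row of the triangular factor, and
      \<open>M'\<close> is the Schur complement that remains after the pivot.\<close>
    define w where "w j = M p j / complex_of_real (sqrt \<mu>)" for j
    define M' where "M' i j = M i j - cnj (w i) * w j" for i j
    have herm: "cnj (M i j) = M j i" if "i < N" "j < N" for i j
      using \<open>psd N M\<close> that unfolding psd_def by metis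
    have ww: "cnj (w i) * w j = cnj (M p i) * M p j / \<mu>" for i j
      using pos by (simp add: w_def flip: of_real_mult)
    have "psd N M'"
      unfolding psd_def
    proof (intro conjI allI impI)
      fix i j assume "i < N" "j < N"
      then show "M' j i = cnj (M' i j)" by (simp add: M'_def herm mult.commute)
    next
      fix x
      define s where "s = mat_apply N M x p"
      have "(\<Sum>i<N. \<Sum>j<N. cnj (x i) * (cnj (w i) * w j) * x j) =
          cnj (\<Sum>i<N. w i * x i) * (\<Sum>j<N. w j * x j)"
        unfolding cnj_sum sum_product by (intro sum.cong refl) simp
      moreover have "(\<Sum>j<N. w j * x j) = s / complex_of_real (sqrt \<mu>)"
        by (simp add: w_def s_def mat_apply_def sum_divide_distrib)
      ultimately have "sesq N M' x x =
          sesq N M x x - cnj (s / complex_of_real (sqrt \<mu>)) * (s / complex_of_real (sqrt \<mu>))"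
        by (simp add: sesq_def M'_def algebra_simps sum_subtractf)
      also have "cnj (s / complex_of_real (sqrt \<mu>)) * (s / complex_of_real (sqrt \<mu>)) =
          complex_of_real ((cmod s)\<^sup>2 / \<mu>)"
        using pos by (simp add: cnj_mult_self flip: of_real_mult)
      finally have 1: "Re (sesq N M' x x) = Re (sesq N M x x) - (cmod s)\<^sup>2 / \<mu>"
        by simp
      \<comment> \<open>This t minimises the quadratic of \<open>sesq_line\<close>, and the minimum
        is exactly the value of the form of \<open>M'\<close> at x.\<close>
      define t where "t = - s / complex_of_real \<mu>"
      have t: "cnj t * s = - complex_of_real ((cmod s)\<^sup>2 / \<mu>)"
        by (simp add: t_def cnj_mult_self)
      have "(cmod t)\<^sup>2 * \<mu> = (cmod s)\<^sup>2 / \<mu>"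
        using pos by (simp add: t_def norm_divide power_divide) (simp add: power2_eq_square)
      moreover have "0 \<le> Re (sesq N M x x) + 2 * Re (cnj t * s) + (cmod t)\<^sup>2 * Re (M p p)"
        unfolding s_def sesq_line[OF p \<open>psd N M\<close>, symmetric]
        using \<open>psd N M\<close> by (simp add: psd_def)
      ultimately have "0 \<le> Re (sesq N M x x) - 2 * ((cmod s)\<^sup>2 / \<mu>) + (cmod s)\<^sup>2 / \<mu>"
        unfolding t \<mu>(2) by simp
      with 1 show "0 \<le> Re (sesq N M' x x)" by simp
    qed
    moreover have "M' i j = 0" if "i < Suc p" "j < N" for i j
    proof (cases "i = p")
      case True
      then show ?thesis using \<mu> pos by (simp add: M'_def ww)
    next
      case False
      \<comment> \<open>Row i is already cleared, hence by Hermitian symmetry entry i of row p is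
        zero, and subtracting the pivot term leaves row i unchanged.\<close>
      then have "i < p" using that by simp
      then have "M i j = 0" "M p i = 0"
        using Suc.prems(3) that p herm[of i p] by auto
      then show ?thesis by (simp add: M'_def ww)
    qed
    ultimately obtain K where K: "\<forall>i<N. \<forall>j<N. gram N K i j = M' i j" "\<forall>k<Suc p. \<forall>i. K k i = 0"
      using Suc.hyps(1)[OF d, of M'] p by auto
    \<comment> \<open>Row p of \<open>K\<close> vanishes, so overwriting it with \<open>w\<close>
      adds exactly the pivot term to the Gram matrix.\<close>
    define L where "L k = (if k = p then w else K k)" for k
    have "gram N L i j = M i j" if ij: "i < N" "j < N" for i j
    proof -
      have "gram N L i j = (\<Sum>k<N. cnj (K k i) * K k j + (if k = p then cnj (w i) * w j else 0))"
        unfolding gram_def by (intro sum.cong) (use K(2) in \<open>auto simp: L_def\<close>)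
      also have "\<dots> = M' i j + cnj (w i) * w j"
        using K(1) ij p by (simp add: sum.distrib gram_def)
      finally show ?thesis by (simp add: M'_def)
    qed
    moreover have "\<forall>k<p. \<forall>i. L k i = 0" using K(2) by (auto simp: L_def)
    ultimately show ?thesis by blast
  qed
qed

lemma psd_imp_gram:
  assumes "psd N M"
  obtains K where "\<And>i j. i < N \<Longrightarrow> j < N \<Longrightarrow> gram N K i j = M i j"
  using psd_imp_gram_aux[of 0 N M] assms by auto

text \<open>The bound on A makes C^2 - A^* A positive semidefinite, so it factors as K^* K. The same
  identity bounds K: the squared norm of Kx is C^2 times that of x, minus the squared norm of
  Ax.\<close>

lemma gram_complement:
  assumes A: "op_bounded N A C"
  obtains K where "op_bounded N K C"
    and "\<And>i j. i < N \<Longrightarrow> j < N \<Longrightarrow> gram N K i j + gram N A i j = (if i = j then of_real (C\<^sup>2) else 0)"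
proof -
  define M where "M i j = (if i = j then of_real (C\<^sup>2) else 0) - gram N A i j" for i j
  have C: "0 \<le> C" using A by (rule op_bounded_nonneg)
  have le: "(l2 N (mat_apply N A x))\<^sup>2 \<le> C\<^sup>2 * (l2 N x)\<^sup>2" for x
    unfolding power_mult_distrib[symmetric]
    using A by (intro power_mono) (auto simp: op_bounded_iff_mat_apply)
  have M: "Re (sesq N M x x) = C\<^sup>2 * (l2 N x)\<^sup>2 - (l2 N (mat_apply N A x))\<^sup>2" for x
  proof -
    have "(\<Sum>i<N. \<Sum>j<N. cnj (x i) * (if i = j then of_real (C\<^sup>2) else 0) * x j) =
        (\<Sum>i<N. of_real (C\<^sup>2) * (cnj (x i) * x i))"
      by (intro sum.cong refl) (simp add: if_distrib[of "\<lambda>x. x * _"] if_distrib[of "\<lambda>x. _ * x"] mult_ac cong: if_cong)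
    also have "\<dots> = complex_of_real (C\<^sup>2 * (l2 N x)\<^sup>2)"
      unfolding of_real_mult[of "C\<^sup>2"] l2_power2_complex sum_distrib_left ..
    finally have "sesq N M x x = complex_of_real (C\<^sup>2 * (l2 N x)\<^sup>2) - sesq N (gram N A) x x"
      by (simp add: sesq_def M_def right_diff_distrib left_diff_distrib sum_subtractf)
    then show ?thesis unfolding sesq_gram by simp
  qed
  have "psd N M"
    unfolding psd_def
  proof (intro conjI allI impI)
    show "M j i = cnj (M i j)" for i j by (simp add: M_def gram_def mult.commute)
    show "0 \<le> Re (sesq N M x x)" for x using M le by simp
  qed
  then obtain K where K: "\<And>i j. i < N \<Longrightarrow> j < N \<Longrightarrow> gram N K i j = M i j"
    using psd_imp_gram by metis
  have "op_bounded N K C"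
    unfolding op_bounded_iff_mat_apply
  proof (intro conjI allI C)
    fix x
    have "complex_of_real ((l2 N (mat_apply N K x))\<^sup>2) = sesq N M x x"
      unfolding sesq_gram[symmetric] by (subst sesq_cong[of N _ M]) (use K in auto)
    then have "(l2 N (mat_apply N K x))\<^sup>2 = Re (sesq N M x x)"
      by (metis Re_complex_of_real)
    then have "(l2 N (mat_apply N K x))\<^sup>2 \<le> C\<^sup>2 * (l2 N x)\<^sup>2"
      unfolding M by simp
    then have "(l2 N (mat_apply N K x))\<^sup>2 \<le> (C * l2 N x)\<^sup>2"
      by (simp add: power_mult_distrib)
    then show "l2 N (mat_apply N K x) \<le> C * l2 N x"
      by (rule power2_le_imp_le) (use C in simp)
  qed
  then show ?thesis using that K by (simp add: M_def)
qed

section \<open>States on bounded functions\<close>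

text \<open>
  The point \<open>(\<alpha>, i, j)\<close> indexes the entry \<open>(i, j)\<close> of the matrix at \<open>\<alpha>\<close>. The values of a function on
  points are junk unless \<open>i\<close> and \<open>j\<close> are below the dimension at \<open>\<alpha>\<close>, except that the unit and the structure
  constants of the comultiplication vanish at such points, so that no side conditions arise below.
\<close>

type_synonym 'i point = "'i \<times> nat \<times> nat"

definition to_matrices :: "('i \<Rightarrow> nat) \<Rightarrow> ('i point \<Rightarrow> complex) \<Rightarrow> 'i \<Rightarrow> complex mat" where
  "to_matrices n \<phi> = (\<lambda>\<alpha>. mat (n \<alpha>) (n \<alpha>) (\<lambda>(i, j). \<phi> (\<alpha>, i, j)))"

definition unif_bounded :: "('i \<Rightarrow> nat) \<Rightarrow> ('i point \<Rightarrow> complex) \<Rightarrow> real \<Rightarrow> bool" where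
  "unif_bounded n \<phi> C \<longleftrightarrow> (\<forall>\<alpha>. op_bounded (n \<alpha>) (\<lambda>i j. \<phi> (\<alpha>, i, j)) C)"

definition bounded_fun :: "('i \<Rightarrow> nat) \<Rightarrow> ('i point \<Rightarrow> complex) set" where
  "bounded_fun n = {\<phi>. \<exists>C. unif_bounded n \<phi> C}"

definition unit_point :: "('i \<Rightarrow> nat) \<Rightarrow> 'i point \<Rightarrow> complex" where
  "unit_point n = (\<lambda>(\<alpha>, i, j). if i = j \<and> i < n \<alpha> then 1 else 0)"

definition adjoint_point :: "('i point \<Rightarrow> complex) \<Rightarrow> 'i point \<Rightarrow> complex" where
  "adjoint_point \<phi> = (\<lambda>(\<alpha>, i, j). cnj (\<phi> (\<alpha>, j, i)))"

definition gram_point :: "('i \<Rightarrow> nat) \<Rightarrow> ('i point \<Rightarrow> complex) \<Rightarrow> 'i point \<Rightarrow> complex" where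
  "gram_point n \<phi> = (\<lambda>(\<alpha>, i, j). gram (n \<alpha>) (\<lambda>i j. \<phi> (\<alpha>, i, j)) i j)"

lemma to_matrices_eq_iff:
  "to_matrices n \<phi> = to_matrices n \<psi> \<longleftrightarrow> (\<forall>\<alpha>. \<forall>i<n \<alpha>. \<forall>j<n \<alpha>. \<phi> (\<alpha>, i, j) = \<psi> (\<alpha>, i, j))"
  by (auto simp: to_matrices_def fun_eq_iff mat_eq_iff)

lemma to_matrices_cong:
  "(\<And>\<alpha> i j. i < n \<alpha> \<Longrightarrow> j < n \<alpha> \<Longrightarrow> \<phi> (\<alpha>, i, j) = \<psi> (\<alpha>, i, j)) \<Longrightarrow> to_matrices n \<phi> = to_matrices n \<psi>"
  by (simp add: to_matrices_eq_iff)

lemma Fnorm_to_matrices_le: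
  assumes "0 \<le> C"
  shows "Fnorm (to_matrices n \<phi>) \<le> ennreal C \<longleftrightarrow> unif_bounded n \<phi> C"
  using assms unfolding Fnorm_def unif_bounded_def to_matrices_def
  by (simp add: SUP_le_iff ennreal_le_iff opnorm_mat_le_iff)

lemma to_matrices_Fb: "to_matrices n \<phi> \<in> Fb n \<longleftrightarrow> \<phi> \<in> bounded_fun n"
proof
  assume "to_matrices n \<phi> \<in> Fb n"
  then have "Fnorm (to_matrices n \<phi>) < \<infinity>" by (simp add: Fb_def)
  then obtain C where "0 \<le> C" "Fnorm (to_matrices n \<phi>) = ennreal C"
    by (metis ennreal_cases infinity_ennreal_def less_irrefl)
  then show "\<phi> \<in> bounded_fun n"
    using Fnorm_to_matrices_le[of C n \<phi>] by (auto simp: bounded_fun_def)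
next
  assume "\<phi> \<in> bounded_fun n"
  then obtain C where C: "unif_bounded n \<phi> C" by (auto simp: bounded_fun_def)
  then have "0 \<le> C" by (auto simp: unif_bounded_def op_bounded_def)
  then have "Fnorm (to_matrices n \<phi>) \<le> ennreal C" using C by (simp add: Fnorm_to_matrices_le)
  also have "\<dots> < \<infinity>" by simp
  finally show "to_matrices n \<phi> \<in> Fb n" by (auto simp: Fb_def Falg_def to_matrices_def)
qed

lemma bounded_fun_add:
  assumes "\<phi> \<in> bounded_fun n" "\<psi> \<in> bounded_fun n"
  shows "(\<lambda>a. \<phi> a + \<psi> a) \<in> bounded_fun n"
proof -
  obtain C C' where "\<And>\<alpha>. op_bounded (n \<alpha>) (\<lambda>i j. \<phi> (\<alpha>, i, j)) C" "\<And>\<alpha>. op_bounded (n \<alpha>) (\<lambda>i j. \<psi> (\<alpha>, i, j)) C'"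
    using assms by (auto simp: bounded_fun_def unif_bounded_def)
  from op_bounded_add[OF this] show ?thesis
    unfolding bounded_fun_def unif_bounded_def by blast
qed

lemma bounded_fun_scale:
  fixes c :: complex
  assumes "\<phi> \<in> bounded_fun n"
  shows "(\<lambda>a. c * \<phi> a) \<in> bounded_fun n"
proof -
  obtain C where "\<And>\<alpha>. op_bounded (n \<alpha>) (\<lambda>i j. \<phi> (\<alpha>, i, j)) C"
    using assms by (auto simp: bounded_fun_def unif_bounded_def)
  from op_bounded_scale[OF this, where c = c] show ?thesis
    unfolding bounded_fun_def unif_bounded_def by blast
qed

lemma unif_bounded_unit_point: "unif_bounded n (unit_point n) 1"
  unfolding unif_bounded_def
proof
  fix \<alpha>
  show "op_bounded (n \<alpha>) (\<lambda>i j. unit_point n (\<alpha>, i, j)) 1"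
    by (subst op_bounded_cong[of _ _ "\<lambda>i j. if i = j then 1 else 0"]) (auto simp: unit_point_def op_bounded_id)
qed

lemma unit_point_bounded_fun: "unit_point n \<in> bounded_fun n"
  using unif_bounded_unit_point unfolding bounded_fun_def by blast

lemma adjoint_point_bounded_fun:
  assumes "\<phi> \<in> bounded_fun n"
  shows "adjoint_point \<phi> \<in> bounded_fun n"
proof -
  obtain C where "\<And>\<alpha>. op_bounded (n \<alpha>) (\<lambda>i j. \<phi> (\<alpha>, i, j)) C"
    using assms by (auto simp: bounded_fun_def unif_bounded_def)
  from op_bounded_adjoint[OF this] show ?thesis
    unfolding bounded_fun_def unif_bounded_def adjoint_point_def by auto
qed

lemma gram_point_bounded_fun:
  assumes "\<phi> \<in> bounded_fun n"
  shows "gram_point n \<phi> \<in> bounded_fun n"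
proof -
  obtain C where "\<And>\<alpha>. op_bounded (n \<alpha>) (\<lambda>i j. \<phi> (\<alpha>, i, j)) C"
    using assms by (auto simp: bounded_fun_def unif_bounded_def)
  from op_bounded_gram[OF this] show ?thesis
    unfolding bounded_fun_def unif_bounded_def gram_point_def by auto
qed

lemma to_matrices_add: "to_matrices n (\<lambda>a. \<phi> a + \<psi> a) = to_matrices n \<phi> + to_matrices n \<psi>"
  by (auto simp: to_matrices_def fun_eq_iff)

lemma to_matrices_scale: "to_matrices n (\<lambda>a. c * \<phi> a) = Fsmult c (to_matrices n \<phi>)"
  by (auto simp: to_matrices_def Fsmult_def fun_eq_iff)

lemma to_matrices_unit_point: "to_matrices n (unit_point n) = Fone n"
  by (auto simp: to_matrices_def Fone_def unit_point_def fun_eq_iff)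

lemma to_matrices_gram_point: "to_matrices n (gram_point n \<phi>) = Fadjoint (to_matrices n \<phi>) * to_matrices n \<phi>"
proof
  fix \<alpha>
  show "to_matrices n (gram_point n \<phi>) \<alpha> = (Fadjoint (to_matrices n \<phi>) * to_matrices n \<phi>) \<alpha>"
    by (rule eq_matI)
      (auto simp: to_matrices_def gram_point_def gram_def Fadjoint_def mat_adjoint_def mat_of_rows_def
        scalar_prod_def lessThan_atLeast0 intro!: sum.cong)
qed

locale state_on =
  fixes n :: "'i \<Rightarrow> nat" and m :: "('i \<Rightarrow> complex mat) \<Rightarrow> complex"
  assumes state: "state n m"
begin

text \<open>The state as a functional on functions of points; passing through
  \<open>to_matrices\<close> makes it insensitive to junk values.\<close>

definition mean :: "('i point \<Rightarrow> complex) \<Rightarrow> complex" where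
  "mean \<phi> = m (to_matrices n \<phi>)"

lemma mean_cong:
  "(\<And>\<alpha> i j. i < n \<alpha> \<Longrightarrow> j < n \<alpha> \<Longrightarrow> \<phi> (\<alpha>, i, j) = \<psi> (\<alpha>, i, j)) \<Longrightarrow> mean \<phi> = mean \<psi>"
  unfolding mean_def using to_matrices_cong by metis

lemma mean_add: "\<phi> \<in> bounded_fun n \<Longrightarrow> \<psi> \<in> bounded_fun n \<Longrightarrow> mean (\<lambda>a. \<phi> a + \<psi> a) = mean \<phi> + mean \<psi>"
  using state by (simp add: mean_def to_matrices_add state_def linear_functional_def to_matrices_Fb)

lemma mean_scale: "\<phi> \<in> bounded_fun n \<Longrightarrow> mean (\<lambda>a. c * \<phi> a) = c * mean \<phi>"
  using state by (simp add: mean_def to_matrices_scale state_def linear_functional_def to_matrices_Fb)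

lemma mean_unit: "mean (unit_point n) = 1"
  using state by (simp add: mean_def to_matrices_unit_point state_def)

lemma mean_gram_nonneg: "\<phi> \<in> bounded_fun n \<Longrightarrow> 0 \<le> mean (gram_point n \<phi>)"
  using state by (simp add: mean_def to_matrices_gram_point state_def to_matrices_Fb)

text \<open>Membership and value are proved together because additivity applies only once the
  partial sum is known to be bounded.\<close>

lemma mean_sum:
  assumes "finite S" "\<And>s. s \<in> S \<Longrightarrow> \<phi> s \<in> bounded_fun n"
  shows "(\<lambda>a. \<Sum>s\<in>S. c s * \<phi> s a) \<in> bounded_fun n \<and>
    mean (\<lambda>a. \<Sum>s\<in>S. c s * \<phi> s a) = (\<Sum>s\<in>S. c s * mean (\<phi> s))"
  using assms
proof (induction S)
  case empty
  show ?case
    using bounded_fun_scale[OF unit_point_bounded_fun, of 0] mean_scale[OF unit_point_bounded_fun, of 0] by simp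
next
  case (insert s S)
  then show ?case
    by (simp add: bounded_fun_add bounded_fun_scale mean_add mean_scale)
qed

text \<open>Positivity of the state on the square of \<phi> + c, expanded. The choices c = 1 and c =
  \<i> yield compatibility with adjoints, and c = -m(\<phi>) yields the Cauchy-Schwarz
  inequality.\<close>

lemma mean_gram_shift:
  assumes "\<phi> \<in> bounded_fun n"
  shows "0 \<le> mean (gram_point n \<phi>) + c * mean (adjoint_point \<phi>) + cnj c * mean \<phi> + c * cnj c"
proof -
  let ?\<psi> = "\<lambda>a. \<phi> a + c * unit_point n a"
  let ?\<chi> = "\<lambda>a. ((gram_point n \<phi> a + c * adjoint_point \<phi> a) + cnj c * \<phi> a) + (c * cnj c) * unit_point n a"
  have "gram_point n ?\<psi> (\<alpha>, i, j) = ?\<chi> (\<alpha>, i, j)" if ij: "i < n \<alpha>" "j < n \<alpha>" for \<alpha> i j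
  proof -
    have "gram_point n ?\<psi> (\<alpha>, i, j) = (\<Sum>k<n \<alpha>. cnj (\<phi> (\<alpha>, k, i)) * \<phi> (\<alpha>, k, j) +
        (if k = j then c * cnj (\<phi> (\<alpha>, k, i)) else 0) + (if k = i then cnj c * \<phi> (\<alpha>, k, j) else 0) +
        (if k = i then if i = j then c * cnj c else 0 else 0))"
      unfolding gram_point_def gram_def prod.case
      by (intro sum.cong refl) (use ij in \<open>auto simp: unit_point_def algebra_simps\<close>)
    also have "\<dots> = ?\<chi> (\<alpha>, i, j)"
      using ij by (simp add: sum.distrib gram_point_def gram_def adjoint_point_def unit_point_def)
    finally show ?thesis .
  qed
  then have "mean (gram_point n ?\<psi>) = mean ?\<chi>"
    by (rule mean_cong)
  also have "\<dots> = mean (gram_point n \<phi>) + c * mean (adjoint_point \<phi>) + cnj c * mean \<phi> + c * cnj c"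
    using assms
    by (simp add: mean_add mean_scale mean_unit bounded_fun_add bounded_fun_scale gram_point_bounded_fun adjoint_point_bounded_fun unit_point_bounded_fun)
  finally show ?thesis
    using mean_gram_nonneg[of ?\<psi>] assms by (simp add: bounded_fun_add bounded_fun_scale unit_point_bounded_fun)
qed

text \<open>Nonnegative complex numbers are real, so the imaginary part of the expanded square
  vanishes: c = \<i> compares real parts and c = 1 imaginary parts.\<close>

lemma mean_adjoint:
  assumes "\<phi> \<in> bounded_fun n"
  shows "mean (adjoint_point \<phi>) = cnj (mean \<phi>)"
proof (rule complex_eqI)
  have *: "Im (mean (gram_point n \<phi>)) = 0"
    using mean_gram_nonneg[OF assms] by (simp add: less_eq_complex_def)
  show "Re (mean (adjoint_point \<phi>)) = Re (cnj (mean \<phi>))"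
    using mean_gram_shift[OF assms, of \<i>] * by (simp add: less_eq_complex_def)
  show "Im (mean (adjoint_point \<phi>)) = Im (cnj (mean \<phi>))"
    using mean_gram_shift[OF assms, of 1] * by (simp add: less_eq_complex_def)
qed

lemma mean_Cauchy_Schwarz:
  assumes "\<phi> \<in> bounded_fun n"
  shows "(cmod (mean \<phi>))\<^sup>2 \<le> Re (mean (gram_point n \<phi>))"
proof -
  have "0 \<le> mean (gram_point n \<phi>) - mean \<phi> * cnj (mean \<phi>)"
    using mean_gram_shift[OF assms, of "- mean \<phi>"] by (simp add: mean_adjoint[OF assms] algebra_simps)
  then show ?thesis
    by (simp add: cnj_mult_self less_eq_complex_def flip: of_real_power)
qed

text \<open>By \<open>gram_complement\<close> at each index, C^2 times the unit is K^* K + \<phi>^*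
  \<phi>. Positivity on the first summand bounds the mean of the second by C^2, and Cauchy-Schwarz
  passes to \<phi>.\<close>

lemma mean_contractive:
  assumes "unif_bounded n \<phi> C"
  shows "cmod (mean \<phi>) \<le> C"
proof -
  have C: "\<And>\<alpha>. op_bounded (n \<alpha>) (\<lambda>i j. \<phi> (\<alpha>, i, j)) C" using assms by (simp add: unif_bounded_def)
  then have "0 \<le> C" by (rule op_bounded_nonneg)
  have "\<exists>K. op_bounded (n \<alpha>) K C \<and> (\<forall>i<n \<alpha>. \<forall>j<n \<alpha>.
      gram (n \<alpha>) K i j + gram (n \<alpha>) (\<lambda>i j. \<phi> (\<alpha>, i, j)) i j = (if i = j then of_real (C\<^sup>2) else 0))" for \<alpha>
    using gram_complement[OF C] by metis
  then obtain K where K: "\<And>\<alpha>. op_bounded (n \<alpha>) (K \<alpha>) C" "\<And>\<alpha> i j. i < n \<alpha> \<Longrightarrow> j < n \<alpha> \<Longrightarrow>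
      gram (n \<alpha>) (K \<alpha>) i j + gram (n \<alpha>) (\<lambda>i j. \<phi> (\<alpha>, i, j)) i j = (if i = j then of_real (C\<^sup>2) else 0)"
    by metis
  define \<kappa> where "\<kappa> = (\<lambda>(\<alpha>, i, j). K \<alpha> i j)"
  have \<phi>: "\<phi> \<in> bounded_fun n" using assms by (auto simp: bounded_fun_def)
  \<comment> \<open>All \<open>K \<alpha>\<close> share the bound \<open>C\<close>, so together they
    form a bounded function to which the state applies.\<close>
  have \<kappa>: "\<kappa> \<in> bounded_fun n" using K(1) by (auto simp: bounded_fun_def unif_bounded_def \<kappa>_def)
  have "mean (\<lambda>a. gram_point n \<kappa> a + gram_point n \<phi> a) = mean (\<lambda>a. of_real (C\<^sup>2) * unit_point n a)"
    by (rule mean_cong) (use K(2) in \<open>simp add: gram_point_def \<kappa>_def unit_point_def\<close>)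
  then have "mean (gram_point n \<kappa>) + mean (gram_point n \<phi>) = of_real (C\<^sup>2)"
    using \<kappa> \<phi> by (simp add: mean_add mean_scale gram_point_bounded_fun unit_point_bounded_fun mean_unit)
  then have "Re (mean (gram_point n \<kappa>)) + Re (mean (gram_point n \<phi>)) = C\<^sup>2"
    by (metis Re_complex_of_real plus_complex.simps(1))
  moreover have "0 \<le> Re (mean (gram_point n \<kappa>))"
    using mean_gram_nonneg[OF \<kappa>] by (simp add: less_eq_complex_def)
  ultimately have "(cmod (mean \<phi>))\<^sup>2 \<le> C\<^sup>2"
    using mean_Cauchy_Schwarz[OF \<phi>] by linarith
  then show ?thesis using \<open>0 \<le> C\<close> by (rule power2_le_imp_le)
qed

text \<open>The form of the matrix of means at z, w is the mean of the combination in
  \<open>h\<close>, so contractivity for scalars gives an operator bound. In use,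
  \<open>h k l\<close> are the matrix coefficients of one function on the product.\<close>

lemma op_bounded_mean:
  assumes "\<And>k l. k < c \<Longrightarrow> l < c \<Longrightarrow> h k l \<in> bounded_fun n" and "0 \<le> C"
    and h: "\<And>z w. unif_bounded n (\<lambda>a. \<Sum>k<c. \<Sum>l<c. cnj (z k) * w l * h k l a) (C * l2 c z * l2 c w)"
  shows "op_bounded c (\<lambda>k l. mean (h k l)) C"
  unfolding op_bounded_def
proof (intro conjI allI)
  fix w z
  have "mean (\<lambda>a. \<Sum>(k, l)\<in>{..<c} \<times> {..<c}. cnj (z k) * w l * h k l a) =
      (\<Sum>(k, l)\<in>{..<c} \<times> {..<c}. cnj (z k) * w l * mean (h k l))"
    using mean_sum[of "{..<c} \<times> {..<c}" "\<lambda>(k, l). h k l" "\<lambda>(k, l). cnj (z k) * w l"] assms(1)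
    by (auto simp: case_prod_beta)
  also have "\<dots> = sesq c (\<lambda>k l. mean (h k l)) z w"
    unfolding sesq_def sum.cartesian_product by (intro sum.cong) auto
  finally show "cmod (sesq c (\<lambda>k l. mean (h k l)) z w) \<le> C * l2 c z * l2 c w"
    using mean_contractive[OF h[of z w]] by (simp add: sum.cartesian_product)
qed fact

end

section \<open>Coalgebras with an invariant mean\<close>

text \<open>Only the support of the structure constants is summed over, so \<phi> may be unbounded.
  Applied in one variable of a function of two, this is \<Delta> \<otimes> \<iota> or \<iota>
  \<otimes> \<Delta> in coordinates.\<close>

definition comul :: "('p \<Rightarrow> 'p \<Rightarrow> 'p \<Rightarrow> complex) \<Rightarrow> ('p \<Rightarrow> complex) \<Rightarrow> 'p \<Rightarrow> 'p \<Rightarrow> complex" where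
  "comul d \<phi> a b = (\<Sum>c | d c a b \<noteq> 0. d c a b * \<phi> c)"

lemma comul_superset:
  assumes "finite S" "{c. d c a b \<noteq> 0} \<subseteq> S"
  shows "comul d \<phi> a b = (\<Sum>c\<in>S. d c a b * \<phi> c)"
  unfolding comul_def by (rule sum.mono_neutral_left) (use assms in auto)

lemma comul_add: "comul d (\<lambda>c. \<phi> c + \<psi> c) a b = comul d \<phi> a b + comul d \<psi> a b"
  by (simp add: comul_def distrib_left sum.distrib)

lemma comul_diff: "comul d (\<lambda>c. \<phi> c - \<psi> c) a b = comul d \<phi> a b - comul d \<psi> a b"
  by (simp add: comul_def right_diff_distrib sum_subtractf)

lemma comul_mult_left: "comul d (\<lambda>c. k * \<phi> c) a b = k * comul d \<phi> a b"
  unfolding comul_def sum_distrib_left by (simp add: mult_ac)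

lemma comul_mult_right: "comul d (\<lambda>c. \<phi> c * k) a b = comul d \<phi> a b * k"
  unfolding comul_def sum_distrib_right by (simp add: mult_ac)

lemma comul_cong: "(\<And>c. d c a b \<noteq> 0 \<Longrightarrow> \<phi> c = \<psi> c) \<Longrightarrow> comul d \<phi> a b = comul d \<psi> a b"
  unfolding comul_def by (rule sum.cong) auto

lemma comul_flip: "comul (\<lambda>c a b. d c b a) \<phi> a b = comul d \<phi> b a"
  by (simp add: comul_def)

locale coalgebra =
  fixes d :: "'p \<Rightarrow> 'p \<Rightarrow> 'p \<Rightarrow> complex"
  assumes fin: "finite {c. d c a b \<noteq> 0}"
    and coassoc: "comul d (\<lambda>y. d x y c) a b = comul d (\<lambda>y. d x a y) b c"
begin

lemma comul_comul: "comul d (\<lambda>y. comul d \<phi> y c) a b = comul d (comul d \<phi> a) b c"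
proof -
  \<comment> \<open>The inner supports vary with y; one finite set containing all of them allows the
    sums to be interchanged.\<close>
  define X where "X = (\<Union>y\<in>{y. d y a b \<noteq> 0}. {x. d x y c \<noteq> 0}) \<union> (\<Union>y\<in>{y. d y b c \<noteq> 0}. {x. d x a y \<noteq> 0})"
  have X: "finite X" unfolding X_def using fin by auto
  have "comul d (\<lambda>y. comul d \<phi> y c) a b = comul d (\<lambda>y. \<Sum>x\<in>X. d x y c * \<phi> x) a b"
    by (intro comul_cong comul_superset X) (auto simp: X_def)
  also have "\<dots> = (\<Sum>x\<in>X. comul d (\<lambda>y. d x y c) a b * \<phi> x)"
    unfolding comul_def sum_distrib_left sum_distrib_right by (subst sum.swap) (simp add: mult_ac)
  also have "\<dots> = (\<Sum>x\<in>X. comul d (\<lambda>y. d x a y) b c * \<phi> x)"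
    by (simp add: coassoc)
  also have "\<dots> = comul d (\<lambda>y. \<Sum>x\<in>X. d x a y * \<phi> x) b c"
    unfolding comul_def sum_distrib_left sum_distrib_right by (subst sum.swap) (simp add: mult_ac)
  also have "\<dots> = comul d (comul d \<phi> a) b c"
    by (intro comul_cong comul_superset[symmetric] X) (auto simp: X_def)
  finally show ?thesis .
qed

end

text \<open>\<open>e\<close> stands for the unit, \<open>B\<close> for the bounded functions and
  \<open>M\<close> for a mean invariant in the first leg. About the image of \<open>e\<close> only
  boundedness of its sections is assumed; its value is derived in \<open>comul_e\<close>.\<close>

locale mean_coalgebra = coalgebra d for d :: "'p \<Rightarrow> 'p \<Rightarrow> 'p \<Rightarrow> complex" +
  fixes e :: "'p \<Rightarrow> complex" and B :: "('p \<Rightarrow> complex) set" and M :: "('p \<Rightarrow> complex) \<Rightarrow> complex"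
  assumes B_add: "\<phi> \<in> B \<Longrightarrow> \<psi> \<in> B \<Longrightarrow> (\<lambda>a. \<phi> a + \<psi> a) \<in> B"
    and B_scale: "\<phi> \<in> B \<Longrightarrow> (\<lambda>a. k * \<phi> a) \<in> B"
    and e_B: "e \<in> B"
    and comul_e_B: "(\<lambda>a. comul d e a b) \<in> B"
    and M_add: "\<phi> \<in> B \<Longrightarrow> \<psi> \<in> B \<Longrightarrow> M (\<lambda>a. \<phi> a + \<psi> a) = M \<phi> + M \<psi>"
    and M_scale: "\<phi> \<in> B \<Longrightarrow> M (\<lambda>a. k * \<phi> a) = k * M \<phi>"
    and M_e: "M e = 1"
    and M_invariant: "\<phi> \<in> B \<Longrightarrow> M (\<lambda>a. comul d \<phi> a b) = M \<phi> * e b"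
begin

text \<open>The mean acts on the first leg and \<Delta> on the second, where it is a finite linear
  combination, so the two commute.\<close>

lemma M_comul:
  assumes "\<And>y. (\<lambda>a. h a y) \<in> B"
  shows "(\<lambda>a. comul d (h a) b c) \<in> B \<and> M (\<lambda>a. comul d (h a) b c) = comul d (\<lambda>y. M (\<lambda>a. h a y)) b c"
proof -
  have "(\<lambda>a. \<Sum>y\<in>S. d y b c * h a y) \<in> B \<and>
      M (\<lambda>a. \<Sum>y\<in>S. d y b c * h a y) = (\<Sum>y\<in>S. d y b c * M (\<lambda>a. h a y))" if "finite S" for S
    using that
  proof (induction S)
    case empty
    show ?case using B_scale[OF e_B, of 0] M_scale[OF e_B, of 0] by simp
  next
    case (insert y S)
    then show ?case by (simp add: B_add B_scale M_add M_scale assms)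
  qed
  from this[OF fin] show ?thesis by (simp add: comul_def)
qed

text \<open>
  Invariance forces unitality: applying the mean to the first leg of \<open>(\<Delta> \<otimes> \<iota>)\<Delta>(1) = (\<iota> \<otimes> \<Delta>)\<Delta>(1)\<close>
  gives \<open>1 \<otimes> 1\<close> on the left and \<open>\<Delta>(1)\<close> on the right.
\<close>

lemma comul_e: "comul d e b c = e b * e c"
proof -
  have M: "M (\<lambda>a. comul d e a y) = e y" for y
    using M_invariant[OF e_B] by (simp add: M_e)
  have "comul d e b c = M (\<lambda>a. comul d (comul d e a) b c)"
    using M_comul[of "comul d e" b c] comul_e_B by (simp add: M)
  also have "\<dots> = M (\<lambda>a. comul d (\<lambda>y. comul d e y c) a b)"
    by (simp add: comul_comul)
  also have "\<dots> = e c * e b"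
    using M_invariant[OF comul_e_B] by (simp add: M)
  finally show ?thesis by simp
qed

text \<open>With u the correction, averaging the cocycle identity gives \<Delta>(u) = e \<otimes> u
  + u \<otimes> e - g, and the last term cancels the defect of f.\<close>

lemma additive_correction:
  fixes f
  defines "g \<equiv> \<lambda>a b. comul d f a b - e a * f b - f a * e b"
  defines "F \<equiv> \<lambda>b. f b + M (\<lambda>a. g a b)"
  assumes g: "\<And>b. (\<lambda>a. g a b) \<in> B"
  shows "comul d F b c = e b * F c + F b * e c"
proof -
  define u where "u b = M (\<lambda>a. g a b)" for b
  \<comment> \<open>The cocycle identity, arranged so that every term on the right is a bounded
    function of a; \<open>f\<close> survives only inside \<open>g\<close>.\<close>
  have 1: "comul d (\<lambda>y. g y c) a b = comul d (g a) b c + (g b c * e a + (- e c) * g a b)" for a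
  proof -
    have "comul d (\<lambda>y. g y c) a b =
        comul d (\<lambda>y. comul d f y c) a b - comul d e a b * f c - comul d f a b * e c"
      by (simp add: g_def comul_diff comul_mult_right)
    moreover have "comul d (g a) b c =
        comul d (comul d f a) b c - e a * comul d f b c - f a * comul d e b c"
      by (simp add: g_def[abs_def] comul_diff comul_mult_left)
    ultimately show ?thesis
      by (simp add: comul_comul comul_e) (simp add: g_def algebra_simps)
  qed
  have "u c * e b = M (\<lambda>a. comul d (\<lambda>y. g y c) a b)"
    using M_invariant[OF g] by (simp add: u_def)
  also have "\<dots> = M (\<lambda>a. comul d (g a) b c + (g b c * e a + (- e c) * g a b))"
    by (simp add: 1)
  also have "\<dots> = M (\<lambda>a. comul d (g a) b c) + (g b c * M e + (- e c) * M (\<lambda>a. g a b))"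
    by (simp only: M_add M_scale B_add B_scale e_B g M_comul[of g b c, OF g])
  also have "\<dots> = comul d u b c + g b c - e c * u b"
    using M_comul[of g b c, OF g] by (simp add: u_def[abs_def] M_e)
  finally have "comul d u b c = e b * u c + u b * e c - g b c"
    by (simp add: algebra_simps)
  then have "comul d (\<lambda>b. f b + u b) b c = e b * (f c + u c) + (f b + u b) * e c"
    by (simp add: comul_add) (simp add: g_def algebra_simps)
  then show ?thesis by (simp add: F_def u_def)
qed

end

section \<open>Structure constants of a comultiplication\<close>

lemma less_kron_index: "i < a \<Longrightarrow> k < c \<Longrightarrow> i * c + k < a * (c::nat)"
  using mult_le_mono1[of "Suc i" a c] by simp

lemma kron_index_cases:
  assumes "p < a * (c::nat)"
  obtains i k where "i < a" "k < c" "p = i * c + k"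
proof
  have "c > 0" using assms by (cases c) auto
  then show "p mod c < c" by simp
  show "p div c < a" using assms by (simp add: less_mult_imp_div_less)
  show "p = p div c * c + p mod c" by simp
qed

definition munit :: "nat \<Rightarrow> nat \<Rightarrow> nat \<Rightarrow> complex mat" where
  "munit N p q = mat N N (\<lambda>ij. if ij = (p, q) then 1 else 0)"

lemma munit_carrier [simp]: "munit N p q \<in> carrier_mat N N"
  by (simp add: munit_def)

lemma star_hom_carrier: "star_hom a b T \<Longrightarrow> x \<in> carrier_mat a a \<Longrightarrow> T x \<in> carrier_mat b b"
  by (simp add: star_hom_def)

text \<open>Linearity on matrix units, by induction over finite sets S of positions with x truncated
  to S.\<close>

lemma star_hom_expand:
  assumes T: "star_hom a b T" and x: "x \<in> carrier_mat a a" and uv: "u < b" "v < b"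
  shows "T x $$ (u, v) = (\<Sum>p<a. \<Sum>q<a. x $$ (p, q) * T (munit a p q) $$ (u, v))"
proof -
  have add: "T (y + z) $$ (u, v) = T y $$ (u, v) + T z $$ (u, v)"
    if "y \<in> carrier_mat a a" "z \<in> carrier_mat a a" for y z
  proof -
    have "T (y + z) = T y + T z" using T that by (simp add: star_hom_def)
    then show ?thesis using star_hom_carrier[OF T that(1)] star_hom_carrier[OF T that(2)] uv by simp
  qed
  have scale: "T (c \<cdot>\<^sub>m y) $$ (u, v) = c * T y $$ (u, v)" if "y \<in> carrier_mat a a" for c y
  proof -
    have "T (c \<cdot>\<^sub>m y) = c \<cdot>\<^sub>m T y" using T that by (simp add: star_hom_def)
    then show ?thesis using star_hom_carrier[OF T that] uv by simp
  qed
  have "T (mat a a (\<lambda>pq. if pq \<in> S then x $$ pq else 0)) $$ (u, v) =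
      (\<Sum>pq\<in>S. x $$ pq * T (munit a (fst pq) (snd pq)) $$ (u, v))" if "finite S" for S
    using that
  proof (induction S)
    case empty
    have "mat a a (\<lambda>pq. if pq \<in> {} then x $$ pq else 0) = 0 \<cdot>\<^sub>m x"
      by (rule eq_matI) (use x in auto)
    then show ?case using scale[OF x, of 0] by simp
  next
    case (insert pq S)
    have "mat a a (\<lambda>rs. if rs \<in> insert pq S then x $$ rs else 0) =
        x $$ pq \<cdot>\<^sub>m munit a (fst pq) (snd pq) + mat a a (\<lambda>rs. if rs \<in> S then x $$ rs else 0)"
      by (rule eq_matI) (use insert in \<open>auto simp: munit_def\<close>)
    then show ?case
      using insert by (simp add: add scale)
  qed
  from this[of "{..<a} \<times> {..<a}"]
  have "T (mat a a (\<lambda>pq. if pq \<in> {..<a} \<times> {..<a} then x $$ pq else 0)) $$ (u, v) =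
      (\<Sum>p<a. \<Sum>q<a. x $$ (p, q) * T (munit a p q) $$ (u, v))"
    by (simp add: sum.cartesian_product case_prod_beta)
  moreover have "mat a a (\<lambda>pq. if pq \<in> {..<a} \<times> {..<a} then x $$ pq else 0) = x"
    by (rule eq_matI) (use x in auto)
  ultimately show ?thesis by simp
qed

section \<open>Families of mutually orthogonal projections\<close>

lemma gram_sum_orthogonal:
  assumes "finite S"
    and "\<And>\<omega> \<omega>'. \<omega> \<in> S \<Longrightarrow> \<omega>' \<in> S \<Longrightarrow>
      (\<Sum>k<N. cnj (P \<omega> k i) * P \<omega>' k j) = (if \<omega> = \<omega>' then P \<omega> i j else 0)"
  shows "gram N (\<lambda>i j. \<Sum>\<omega>\<in>S. P \<omega> i j) i j = (\<Sum>\<omega>\<in>S. P \<omega> i j)"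
proof -
  have "gram N (\<lambda>i j. \<Sum>\<omega>\<in>S. P \<omega> i j) i j = (\<Sum>k<N. \<Sum>\<omega>\<in>S. \<Sum>\<omega>'\<in>S. cnj (P \<omega> k i) * P \<omega>' k j)"
    unfolding gram_def cnj_sum sum_product ..
  also have "\<dots> = (\<Sum>\<omega>\<in>S. \<Sum>k<N. \<Sum>\<omega>'\<in>S. cnj (P \<omega> k i) * P \<omega>' k j)"
    by (rule sum.swap)
  also have "\<dots> = (\<Sum>\<omega>\<in>S. \<Sum>\<omega>'\<in>S. \<Sum>k<N. cnj (P \<omega> k i) * P \<omega>' k j)"
    by (intro sum.cong refl sum.swap)
  also have "\<dots> = (\<Sum>\<omega>\<in>S. \<Sum>\<omega>'\<in>S. if \<omega> = \<omega>' then P \<omega> i j else 0)"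
    by (intro sum.cong refl assms(2))
  finally show ?thesis using assms(1) by simp
qed

lemma gram_diag: "gram N A i i = complex_of_real ((l2 N (\<lambda>k. A k i))\<^sup>2)"
  unfolding gram_def l2_power2_complex ..

text \<open>For a projection, t i is both the i-th diagonal entry and the squared norm of the i-th
  column. Cauchy-Schwarz bounds the squared modulus of entry (i, j) by the product of t i and t j;
  summing over all entries gives H \<le> H^2 for the trace H, and H > 0.\<close>

lemma projection_trace_ge_1:
  assumes P: "\<And>i j. i < N \<Longrightarrow> j < N \<Longrightarrow> gram N P i j = P i j"
    and nz: "i < N" "j < N" "P i j \<noteq> 0"
  shows "1 \<le> (\<Sum>i<N. Re (P i i))"
proof -
  define t where "t i = (l2 N (\<lambda>k. P k i))\<^sup>2" for i
  define H where "H = (\<Sum>i<N. t i)"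
  have t: "Re (P i i) = t i" if "i < N" for i
    using P[OF that that, symmetric] by (simp add: gram_diag t_def del: of_real_power)
  have le: "(cmod (P i j))\<^sup>2 \<le> t i * t j" if "i < N" "j < N" for i j
  proof -
    have "cmod (P i j) \<le> l2 N (\<lambda>k. P k i) * l2 N (\<lambda>k. P k j)"
      using l2_Cauchy_Schwarz[where N = N and y = "\<lambda>k. P k i" and x = "\<lambda>k. P k j"] P[OF that] by (simp add: gram_def)
    then have "(cmod (P i j))\<^sup>2 \<le> (l2 N (\<lambda>k. P k i) * l2 N (\<lambda>k. P k j))\<^sup>2"
      by (intro power_mono) auto
    then show ?thesis by (simp add: t_def power_mult_distrib)
  qed
  have "H = (\<Sum>j<N. \<Sum>i<N. (cmod (P i j))\<^sup>2)"
    unfolding H_def t_def l2_power2 ..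
  also have "\<dots> \<le> (\<Sum>j<N. \<Sum>i<N. t i * t j)"
    by (intro sum_mono le) auto
  also have "\<dots> = H * H"
    unfolding H_def by (subst sum.swap) (simp add: sum_product)
  finally have "H * 1 \<le> H * H" by simp
  moreover have "H > 0"
  proof -
    have "0 < (cmod (P i j))\<^sup>2" using nz(3) by simp
    also have "\<dots> \<le> t i * t j" by (rule le[OF nz(1,2)])
    finally have "0 < t i * t j" .
    then have "t i \<noteq> 0" by auto
    then have "0 < t i" by (simp add: t_def)
    also have "\<dots> \<le> H" unfolding H_def using nz(1) by (intro member_le_sum) (auto simp: t_def)
    finally show ?thesis .
  qed
  ultimately have "1 \<le> H" by (simp only: mult_le_cancel_left_pos)
  then show ?thesis by (simp add: H_def t)
qed

text \<open>The sum of the family is again a projection, so its trace is at most N, while each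
  member contributes at least 1.\<close>

lemma card_orthogonal_projections:
  assumes S: "finite S"
    and orth: "\<And>\<omega> \<omega>' i j. \<omega> \<in> S \<Longrightarrow> \<omega>' \<in> S \<Longrightarrow> i < N \<Longrightarrow> j < N \<Longrightarrow>
      (\<Sum>k<N. cnj (P \<omega> k i) * P \<omega>' k j) = (if \<omega> = \<omega>' then P \<omega> i j else 0)"
    and nz: "\<And>\<omega>. \<omega> \<in> S \<Longrightarrow> \<exists>i<N. \<exists>j<N. P \<omega> i j \<noteq> 0"
  shows "card S \<le> N"
proof -
  let ?Q = "\<lambda>i j. \<Sum>\<omega>\<in>S. P \<omega> i j"
  have Q: "gram N ?Q i j = ?Q i j" if "i < N" "j < N" for i j
    using S orth that by (intro gram_sum_orthogonal) auto
  \<comment> \<open>A diagonal entry of a projection is the squared norm of a column, which is the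
    image of a unit vector.\<close>
  have Qii: "Re (?Q i i) \<le> 1" if "i < N" for i
  proof -
    have "l2 N (mat_apply N ?Q (\<lambda>k. if k = i then 1 else 0)) \<le> 1"
      using op_bounded_unit_ball[OF op_bounded_projection[of N ?Q, OF Q]] l2_unit[OF that] by simp
    moreover have "mat_apply N ?Q (\<lambda>k. if k = i then 1 else 0) = (\<lambda>k. ?Q k i)"
      using that by (simp add: mat_apply_def fun_eq_iff if_distrib[of "\<lambda>x. _ * x"] cong: if_cong)
    moreover have "Re (?Q i i) = (l2 N (\<lambda>k. ?Q k i))\<^sup>2"
      using Q[OF that that, symmetric] unfolding gram_diag by (metis Re_complex_of_real)
    ultimately show ?thesis by (simp add: power_le_one)
  qed
  have "real (card S) = (\<Sum>\<omega>\<in>S. 1)" by simp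
  also have "\<dots> \<le> (\<Sum>\<omega>\<in>S. \<Sum>i<N. Re (P \<omega> i i))"
  proof (rule sum_mono)
    fix \<omega> assume \<omega>: "\<omega> \<in> S"
    then obtain i j where "i < N" "j < N" "P \<omega> i j \<noteq> 0" using nz by blast
    then show "1 \<le> (\<Sum>i<N. Re (P \<omega> i i))"
      using orth[OF \<omega> \<omega>] by (intro projection_trace_ge_1) (auto simp: gram_def)
  qed
  also have "\<dots> = (\<Sum>i<N. Re (?Q i i))"
    by (subst sum.swap) simp
  also have "\<dots> \<le> (\<Sum>i<N. 1)"
    by (intro sum_mono Qii) simp
  finally show ?thesis by simp
qed

lemma kron_index_div: "k < c \<Longrightarrow> (i * c + k) div c = (i :: nat)"
  by simp

text \<open>Both sides equal the sum over the union of T with all in-range points above indices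
  occurring in T; the points added on either side contribute 0 by one of the two support
  conditions.\<close>

lemma Sum_any_points:
  fixes \<phi> :: "'i point \<Rightarrow> complex"
  assumes T: "finite T" "\<And>c. c \<notin> T \<Longrightarrow> \<phi> c = 0"
    and supp: "\<And>\<omega> p q. \<not> (p < n \<omega> \<and> q < n \<omega>) \<Longrightarrow> \<phi> (\<omega>, p, q) = 0"
  shows "Sum_any (\<lambda>\<omega>. \<Sum>p<n \<omega>. \<Sum>q<n \<omega>. \<phi> (\<omega>, p, q)) = sum \<phi> T"
proof -
  let ?S = "fst ` T"
  let ?U = "Sigma ?S (\<lambda>\<omega>. {..<n \<omega>} \<times> {..<n \<omega>})"
  have S: "finite ?S" using T by simp
  have "{\<omega>. (\<Sum>p<n \<omega>. \<Sum>q<n \<omega>. \<phi> (\<omega>, p, q)) \<noteq> 0} \<subseteq> ?S"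
  proof (rule subsetI, rule ccontr)
    fix \<omega> assume "\<omega> \<in> {\<omega>. (\<Sum>p<n \<omega>. \<Sum>q<n \<omega>. \<phi> (\<omega>, p, q)) \<noteq> 0}" and "\<omega> \<notin> ?S"
    then have "\<phi> (\<omega>, p, q) = 0" for p q using T(2) by force
    with \<open>\<omega> \<in> _\<close> show False by simp
  qed
  then have "Sum_any (\<lambda>\<omega>. \<Sum>p<n \<omega>. \<Sum>q<n \<omega>. \<phi> (\<omega>, p, q)) =
      (\<Sum>\<omega>\<in>?S. \<Sum>p<n \<omega>. \<Sum>q<n \<omega>. \<phi> (\<omega>, p, q))"
    by (rule Sum_any.expand_superset[OF S])
  also have "\<dots> = (\<Sum>\<omega>\<in>?S. \<Sum>pq\<in>{..<n \<omega>} \<times> {..<n \<omega>}. \<phi> (\<omega>, pq))"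
    by (simp add: sum.cartesian_product case_prod_beta)
  also have "\<dots> = sum \<phi> ?U"
    using S by (simp add: sum.Sigma case_prod_beta)
  also have "\<dots> = sum \<phi> (?U \<union> T)"
  proof (rule sum.mono_neutral_left)
    show "\<forall>c\<in>(?U \<union> T) - ?U. \<phi> c = 0"
    proof
      fix c assume c: "c \<in> (?U \<union> T) - ?U"
      obtain \<omega> p q where \<omega>: "c = (\<omega>, p, q)" by (metis prod_cases3)
      have "\<omega> \<in> ?S" using c by (force simp: \<omega>)
      then show "\<phi> c = 0" using c supp[of p \<omega> q] by (auto simp: \<omega>)
    qed
  qed (use S T in auto)
  also have "\<dots> = sum \<phi> T"
  proof (rule sum.mono_neutral_right)
    show "\<forall>c\<in>(?U \<union> T) - T. \<phi> c = 0" using T(2) by auto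
  qed (use S T in auto)
  finally show ?thesis .
qed

section \<open>Functions and their tensor products in coordinates\<close>

definition entries :: "('i \<Rightarrow> complex mat) \<Rightarrow> 'i point \<Rightarrow> complex" where
  "entries f = (\<lambda>(\<alpha>, i, j). f \<alpha> $$ (i, j))"

lemma to_matrices_entries:
  assumes "f \<in> Falg n"
  shows "to_matrices n (entries f) = f"
proof
  fix \<alpha>
  have "f \<alpha> \<in> carrier_mat (n \<alpha>) (n \<alpha>)" using assms by (simp add: Falg_def)
  then show "to_matrices n (entries f) \<alpha> = f \<alpha>"
    by (intro eq_matI) (auto simp: to_matrices_def entries_def)
qed

lemma to_matrices_Falg: "to_matrices n \<phi> \<in> Falg n"
  by (simp add: to_matrices_def Falg_def)

definition valid :: "('i \<Rightarrow> nat) \<Rightarrow> 'i point \<Rightarrow> bool" where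
  "valid n = (\<lambda>(\<alpha>, i, j). i < n \<alpha> \<and> j < n \<alpha>)"

text \<open>Regroups the Kronecker indices by leg instead of by row and column: an element of the
  product algebra becomes a function of two points, and a tensor product becomes a product of
  values.\<close>

fun kron_entry :: "('i \<Rightarrow> nat) \<Rightarrow> ('i \<times> 'i \<Rightarrow> complex mat) \<Rightarrow> 'i point \<Rightarrow> 'i point \<Rightarrow> complex" where
  "kron_entry n G (\<alpha>, s, t) (\<beta>, k, l) = G (\<alpha>, \<beta>) $$ (s * n \<beta> + k, t * n \<beta> + l)"

text \<open>
  The structure constants of the comultiplication with respect to matrix units, so that the whole
  situation becomes one about a coalgebra with a distinguished basis.
\<close>

definition dcoef :: "('i \<Rightarrow> nat) \<Rightarrow> 'i comult_family \<Rightarrow> 'i point \<Rightarrow> 'i point \<Rightarrow> 'i point \<Rightarrow> complex" where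
  "dcoef n D = (\<lambda>(\<omega>, p, q) a b. if valid n (\<omega>, p, q) \<and> valid n a \<and> valid n b
     then kron_entry n (\<lambda>(\<beta>, \<gamma>). D \<omega> \<beta> \<gamma> (munit (n \<omega>) p q)) a b else 0)"

lemma dcoef_valid: "dcoef n D c a b \<noteq> 0 \<Longrightarrow> valid n c \<and> valid n a \<and> valid n b"
  by (auto simp: dcoef_def split: prod.splits if_splits)

section \<open>The comultiplication in coordinates: finite supports and coassociativity\<close>

locale comult_system =
  fixes n :: "'i \<Rightarrow> nat" and D :: "'i comult_family"
  assumes comult: "comultiplication n D"
begin

lemma star_hom: "star_hom (n \<alpha>) (n \<beta> * n \<gamma>) (D \<alpha> \<beta> \<gamma>)"
  using comult by (simp add: comultiplication_def)

lemma D_carrier [simp]: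
  "x \<in> carrier_mat (n \<alpha>) (n \<alpha>) \<Longrightarrow> D \<alpha> \<beta> \<gamma> x \<in> carrier_mat (n \<beta> * n \<gamma>) (n \<beta> * n \<gamma>)"
  using star_hom_carrier[OF star_hom] .

abbreviation proj :: "'i \<Rightarrow> 'i \<Rightarrow> 'i \<Rightarrow> nat \<Rightarrow> nat \<Rightarrow> complex" where
  "proj \<beta> \<gamma> \<omega> i j \<equiv> D \<omega> \<beta> \<gamma> (1\<^sub>m (n \<omega>)) $$ (i, j)"

text \<open>The image of the unit under a star homomorphism is self-adjoint and idempotent, and
  distinct upper indices are orthogonal by the axiom. The conjugate in the sum casts this in the
  form used for \<open>gram\<close>.\<close>

lemma proj_orthogonal:
  assumes ij: "i < n \<beta> * n \<gamma>" "j < n \<beta> * n \<gamma>"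
  shows "(\<Sum>k<n \<beta> * n \<gamma>. cnj (proj \<beta> \<gamma> \<omega> k i) * proj \<beta> \<gamma> \<omega>' k j) =
    (if \<omega> = \<omega>' then proj \<beta> \<gamma> \<omega> i j else 0)"
proof -
  let ?N = "n \<beta> * n \<gamma>"
  let ?P = "\<lambda>\<omega>. D \<omega> \<beta> \<gamma> (1\<^sub>m (n \<omega>))"
  have P: "?P \<omega> \<in> carrier_mat ?N ?N" for \<omega> by simp
  have "mat_adjoint (1\<^sub>m (n \<omega>) :: complex mat) = 1\<^sub>m (n \<omega>)"
    by (rule eq_matI) (auto simp: mat_adjoint_def mat_of_rows_def)
  then have "mat_adjoint (?P \<omega>) = ?P \<omega>"
    using star_hom[of \<omega> \<beta> \<gamma>] unfolding star_hom_def by (metis one_carrier_mat)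
  moreover have "mat_adjoint (?P \<omega>) $$ (i, k) = cnj (?P \<omega> $$ (k, i))" if "k < ?N" for k
    using ij that P[of \<omega>] carrier_matD[OF P[of \<omega>]] by (simp add: mat_adjoint_def mat_of_rows_def)
  ultimately have "(\<Sum>k<?N. cnj (proj \<beta> \<gamma> \<omega> k i) * proj \<beta> \<gamma> \<omega>' k j) =
      (\<Sum>k<?N. ?P \<omega> $$ (i, k) * ?P \<omega>' $$ (k, j))"
    by (intro sum.cong) auto
  also have "\<dots> = (?P \<omega> * ?P \<omega>') $$ (i, j)"
    using ij carrier_matD[OF P[of \<omega>]] carrier_matD[OF P[of \<omega>']]
    by (simp add: scalar_prod_def lessThan_atLeast0)
  also have "?P \<omega> * ?P \<omega>' = (if \<omega> = \<omega>' then ?P \<omega> else 0\<^sub>m ?N ?N)"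
  proof (cases "\<omega> = \<omega>'")
    case True
    have "?P \<omega> * ?P \<omega> = D \<omega> \<beta> \<gamma> (1\<^sub>m (n \<omega>) * 1\<^sub>m (n \<omega>))"
      using star_hom[of \<omega> \<beta> \<gamma>] unfolding star_hom_def by (metis one_carrier_mat)
    then show ?thesis using True by simp
  next
    case False
    then show ?thesis using comult by (simp add: comultiplication_def)
  qed
  finally show ?thesis using ij by simp
qed

definition upper_supp :: "'i \<Rightarrow> 'i \<Rightarrow> 'i set" where
  "upper_supp \<beta> \<gamma> = {\<omega>. \<exists>i<n \<beta> * n \<gamma>. \<exists>j<n \<beta> * n \<gamma>. proj \<beta> \<gamma> \<omega> i j \<noteq> 0}"

lemma finite_upper_supp: "finite (upper_supp \<beta> \<gamma>)"
proof (rule ccontr)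
  assume "infinite (upper_supp \<beta> \<gamma>)"
  then obtain S where S: "S \<subseteq> upper_supp \<beta> \<gamma>" "finite S" "card S = Suc (n \<beta> * n \<gamma>)"
    using infinite_arbitrarily_large by blast
  have "card S \<le> n \<beta> * n \<gamma>"
    by (rule card_orthogonal_projections[where P = "proj \<beta> \<gamma>"])
      (use S proj_orthogonal in \<open>auto simp: upper_supp_def\<close>)
  then show False using S by simp
qed

text \<open>D(x) = D(1) D(x), so a component that kills the unit vanishes.\<close>

lemma D_outside_upper_supp:
  assumes "\<omega> \<notin> upper_supp \<beta> \<gamma>" and x: "x \<in> carrier_mat (n \<omega>) (n \<omega>)"
  shows "D \<omega> \<beta> \<gamma> x = 0\<^sub>m (n \<beta> * n \<gamma>) (n \<beta> * n \<gamma>)"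
proof -
  have "D \<omega> \<beta> \<gamma> (1\<^sub>m (n \<omega>)) = 0\<^sub>m (n \<beta> * n \<gamma>) (n \<beta> * n \<gamma>)"
    by (rule eq_matI) (use assms(1) carrier_matD[OF D_carrier[of "1\<^sub>m (n \<omega>)" \<omega> \<beta> \<gamma>]] in \<open>auto simp: upper_supp_def\<close>)
  moreover have "D \<omega> \<beta> \<gamma> (1\<^sub>m (n \<omega>) * x) = D \<omega> \<beta> \<gamma> (1\<^sub>m (n \<omega>)) * D \<omega> \<beta> \<gamma> x"
    using star_hom[of \<omega> \<beta> \<gamma>] x unfolding star_hom_def by (metis one_carrier_mat)
  ultimately show ?thesis
    using x left_mult_zero_mat[OF D_carrier[OF x]] by simp
qed

text \<open>At each pair of indices the image of the unit is a finite sum of orthogonal projections,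
  hence a projection. This bound lets the mean be applied to its sections.\<close>

lemma op_bounded_comult_Fone:
  "op_bounded (n \<beta> * n \<gamma>) (\<lambda>p q. comult n D (Fone n) (\<beta>, \<gamma>) $$ (p, q)) 1"
proof (rule op_bounded_projection)
  let ?N = "n \<beta> * n \<gamma>"
  let ?S = "upper_supp \<beta> \<gamma>"
  have eq: "comult n D (Fone n) (\<beta>, \<gamma>) $$ (p, q) = (\<Sum>\<omega>\<in>?S. proj \<beta> \<gamma> \<omega> p q)"
    if "p < ?N" "q < ?N" for p q
    using that unfolding comult_def Fone_def
    by (auto simp: mat_Sum_def upper_supp_def intro!: Sum_any.expand_superset finite_upper_supp[unfolded upper_supp_def])
  fix i j assume ij: "i < ?N" "j < ?N"
  have "gram ?N (\<lambda>p q. comult n D (Fone n) (\<beta>, \<gamma>) $$ (p, q)) i j =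
      gram ?N (\<lambda>p q. \<Sum>\<omega>\<in>?S. proj \<beta> \<gamma> \<omega> p q) i j"
    unfolding gram_def by (intro sum.cong) (use ij eq in auto)
  also have "\<dots> = (\<Sum>\<omega>\<in>?S. proj \<beta> \<gamma> \<omega> i j)"
    by (rule gram_sum_orthogonal) (use ij proj_orthogonal finite_upper_supp in auto)
  finally show "gram ?N (\<lambda>p q. comult n D (Fone n) (\<beta>, \<gamma>) $$ (p, q)) i j =
      comult n D (Fone n) (\<beta>, \<gamma>) $$ (i, j)"
    using eq ij by simp
qed

lemma finite_dcoef: "finite {c. dcoef n D c a b \<noteq> 0}"
proof -
  obtain \<beta> i j \<gamma> k l where ab: "a = (\<beta>, i, j)" "b = (\<gamma>, k, l)" by (metis prod_cases3)
  have "{c. dcoef n D c a b \<noteq> 0} \<subseteq> Sigma (upper_supp \<beta> \<gamma>) (\<lambda>\<omega>. {..<n \<omega>} \<times> {..<n \<omega>})"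
  proof
    fix c assume c: "c \<in> {c. dcoef n D c a b \<noteq> 0}"
    obtain \<omega> p q where \<omega>: "c = (\<omega>, p, q)" by (metis prod_cases3)
    have v: "valid n c" "valid n a" "valid n b" using c dcoef_valid[of n D c a b] by auto
    have "\<omega> \<in> upper_supp \<beta> \<gamma>"
    proof (rule ccontr)
      assume "\<omega> \<notin> upper_supp \<beta> \<gamma>"
      from D_outside_upper_supp[OF this munit_carrier] show False
        using c v by (auto simp: \<omega> ab dcoef_def valid_def less_kron_index)
    qed
    then show "c \<in> Sigma (upper_supp \<beta> \<gamma>) (\<lambda>\<omega>. {..<n \<omega>} \<times> {..<n \<omega>})"
      using v by (auto simp: \<omega> valid_def)
  qed
  then show ?thesis
    by (rule finite_subset) (use finite_upper_supp in auto)
qed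

lemma D_expand:
  assumes "x \<in> carrier_mat (n \<omega>) (n \<omega>)" "valid n (\<beta>, i, j)" "valid n (\<gamma>, k, l)"
  shows "D \<omega> \<beta> \<gamma> x $$ (i * n \<gamma> + k, j * n \<gamma> + l) =
    (\<Sum>p<n \<omega>. \<Sum>q<n \<omega>. x $$ (p, q) * dcoef n D (\<omega>, p, q) (\<beta>, i, j) (\<gamma>, k, l))"
  using assms star_hom_expand[OF star_hom[of \<omega> \<beta> \<gamma>] assms(1), of "i * n \<gamma> + k" "j * n \<gamma> + l"]
  by (auto simp: valid_def dcoef_def less_kron_index intro!: sum.cong)

text \<open>Expanding every f \<omega> in matrix units turns the sum over all indices in
  \<open>comult\<close> into the finite sum of \<open>comul\<close>.\<close>

lemma comult_entry:
  assumes "f \<in> Falg n" "valid n a" "valid n b"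
  shows "kron_entry n (comult n D f) a b = comul (dcoef n D) (entries f) a b"
proof -
  obtain \<beta> i j \<gamma> k l where ab: "a = (\<beta>, i, j)" "b = (\<gamma>, k, l)" by (metis prod_cases3)
  let ?\<phi> = "\<lambda>c. dcoef n D c a b * entries f c"
  have "kron_entry n (comult n D f) a b =
      Sum_any (\<lambda>\<omega>. D \<omega> \<beta> \<gamma> (f \<omega>) $$ (i * n \<gamma> + k, j * n \<gamma> + l))"
    using assms(2,3) by (simp add: ab comult_def mat_Sum_def valid_def less_kron_index)
  also have "\<dots> = Sum_any (\<lambda>\<omega>. \<Sum>p<n \<omega>. \<Sum>q<n \<omega>. ?\<phi> (\<omega>, p, q))"
    using D_expand[of "f _"] assms by (simp add: ab Falg_def entries_def mult.commute)
  also have "\<dots> = sum ?\<phi> {c. dcoef n D c a b \<noteq> 0}"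
    by (rule Sum_any_points[OF finite_dcoef]) (use dcoef_valid[of n D _ a b] in \<open>fastforce simp: valid_def\<close>)+
  finally show ?thesis by (simp add: comul_def)
qed

text \<open>The coassociativity axiom is evaluated at a single matrix unit and read off at a single
  entry. If some point is out of range, both sides vanish because \<open>dcoef\<close> does.\<close>

lemma dcoef_coassoc:
  "comul (dcoef n D) (\<lambda>y. dcoef n D x y c) a b = comul (dcoef n D) (\<lambda>y. dcoef n D x a y) b c"
proof (cases "valid n a \<and> valid n b \<and> valid n c \<and> valid n x")
  case False
  have "comul (dcoef n D) (\<lambda>y. dcoef n D x y c) a b = 0"
  proof (unfold comul_def, rule sum.neutral, rule ballI)
    fix y assume "y \<in> {y. dcoef n D y a b \<noteq> 0}"
    then show "dcoef n D y a b * dcoef n D x y c = 0"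
      using False dcoef_valid[of n D y a b] dcoef_valid[of n D x y c] by auto
  qed
  moreover have "comul (dcoef n D) (\<lambda>y. dcoef n D x a y) b c = 0"
  proof (unfold comul_def, rule sum.neutral, rule ballI)
    fix y assume "y \<in> {y. dcoef n D y b c \<noteq> 0}"
    then show "dcoef n D y b c * dcoef n D x a y = 0"
      using False dcoef_valid[of n D y b c] dcoef_valid[of n D x a y] by auto
  qed
  ultimately show ?thesis by simp
next
  case True
  obtain \<alpha> s t \<beta> i j \<gamma> k l \<kappa> p q where abc: "a = (\<alpha>, s, t)" "b = (\<beta>, i, j)" "c = (\<gamma>, k, l)" "x = (\<kappa>, p, q)"
    by (metis prod_cases3)
  let ?x = "munit (n \<kappa>) p q"
  let ?P = "(s * n \<beta> + i) * n \<gamma> + k" and ?Q = "(t * n \<beta> + j) * n \<gamma> + l"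
  \<comment> \<open>The same row and column numbers, bracketed as needed for \<iota> \<otimes>
    \<Delta>.\<close>
  let ?P' = "s * (n \<beta> * n \<gamma>) + (i * n \<gamma> + k)" and ?Q' = "t * (n \<beta> * n \<gamma>) + (j * n \<gamma> + l)"
  have lt: "s < n \<alpha>" "t < n \<alpha>" "i < n \<beta>" "j < n \<beta>" "k < n \<gamma>" "l < n \<gamma>" "p < n \<kappa>" "q < n \<kappa>"
    using True by (auto simp: abc valid_def)
  have PQ: "?P < n \<alpha> * n \<beta> * n \<gamma>" "?Q < n \<alpha> * n \<beta> * n \<gamma>"
    using lt by (simp_all add: less_kron_index)
  have PQ': "?P' = ?P" "?Q' = ?Q" by (simp_all add: algebra_simps)
  have lt2: "i * n \<gamma> + k < n \<beta> * n \<gamma>" "j * n \<gamma> + l < n \<beta> * n \<gamma>"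
    using lt by (simp_all add: less_kron_index)
  let ?L = "\<lambda>\<omega>. tensor_id (n \<omega>) (n \<alpha> * n \<beta>) (n \<gamma>) (D \<omega> \<alpha> \<beta>) (D \<kappa> \<omega> \<gamma> ?x)"
  let ?R = "\<lambda>\<omega>. id_tensor (n \<alpha>) (n \<omega>) (n \<beta> * n \<gamma>) (D \<omega> \<beta> \<gamma>) (D \<kappa> \<alpha> \<omega> ?x)"
  let ?\<phi> = "\<lambda>y. dcoef n D y a b * dcoef n D x y c"
  let ?\<psi> = "\<lambda>y. dcoef n D y b c * dcoef n D x a y"
  have L: "?L \<omega> $$ (?P, ?Q) = (\<Sum>p'<n \<omega>. \<Sum>q'<n \<omega>. ?\<phi> (\<omega>, p', q'))" for \<omega>
  proof -
    have "?L \<omega> $$ (?P, ?Q) =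
        D \<omega> \<alpha> \<beta> (lcoeff (n \<omega>) (n \<gamma>) (D \<kappa> \<omega> \<gamma> ?x) k l) $$ (s * n \<beta> + i, t * n \<beta> + j)"
      using PQ lt by (simp add: tensor_id_def)
    also have "\<dots> = (\<Sum>p'<n \<omega>. \<Sum>q'<n \<omega>.
        lcoeff (n \<omega>) (n \<gamma>) (D \<kappa> \<omega> \<gamma> ?x) k l $$ (p', q') * dcoef n D (\<omega>, p', q') a b)"
      unfolding abc by (rule D_expand) (use lt in \<open>auto simp: lcoeff_def valid_def\<close>)
    also have "\<dots> = (\<Sum>p'<n \<omega>. \<Sum>q'<n \<omega>. ?\<phi> (\<omega>, p', q'))"
      by (intro sum.cong refl) (use lt in \<open>simp add: abc lcoeff_def dcoef_def valid_def\<close>)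
    finally show ?thesis .
  qed
  have R: "?R \<omega> $$ (?P, ?Q) = (\<Sum>p'<n \<omega>. \<Sum>q'<n \<omega>. ?\<psi> (\<omega>, p', q'))" for \<omega>
  proof -
    have "?R \<omega> $$ (?P', ?Q') =
        D \<omega> \<beta> \<gamma> (rcoeff (n \<alpha>) (n \<omega>) (D \<kappa> \<alpha> \<omega> ?x) s t) $$ (i * n \<gamma> + k, j * n \<gamma> + l)"
      using PQ[folded PQ'] lt2 by (simp add: id_tensor_def mult.assoc kron_index_div)
    also have "\<dots> = (\<Sum>p'<n \<omega>. \<Sum>q'<n \<omega>.
        rcoeff (n \<alpha>) (n \<omega>) (D \<kappa> \<alpha> \<omega> ?x) s t $$ (p', q') * dcoef n D (\<omega>, p', q') b c)"
      unfolding abc by (rule D_expand) (use lt in \<open>auto simp: rcoeff_def valid_def\<close>)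
    also have "\<dots> = (\<Sum>p'<n \<omega>. \<Sum>q'<n \<omega>. ?\<psi> (\<omega>, p', q'))"
      by (intro sum.cong refl) (use lt in \<open>simp add: abc rcoeff_def dcoef_def valid_def\<close>)
    finally show ?thesis unfolding PQ' .
  qed
  have "mat_Sum (n \<alpha> * n \<beta> * n \<gamma>) ?L = mat_Sum (n \<alpha> * n \<beta> * n \<gamma>) ?R"
    by (rule comult[unfolded comultiplication_def, THEN conjunct2, THEN conjunct2, rule_format,
          OF munit_carrier])
  then have "mat_Sum (n \<alpha> * n \<beta> * n \<gamma>) ?L $$ (?P, ?Q) = mat_Sum (n \<alpha> * n \<beta> * n \<gamma>) ?R $$ (?P, ?Q)"
    by simp
  then have "Sum_any (\<lambda>\<omega>. ?L \<omega> $$ (?P, ?Q)) = Sum_any (\<lambda>\<omega>. ?R \<omega> $$ (?P, ?Q))"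
    using PQ by (simp add: mat_Sum_def)
  then have "Sum_any (\<lambda>\<omega>. \<Sum>p'<n \<omega>. \<Sum>q'<n \<omega>. ?\<phi> (\<omega>, p', q')) =
      Sum_any (\<lambda>\<omega>. \<Sum>p'<n \<omega>. \<Sum>q'<n \<omega>. ?\<psi> (\<omega>, p', q'))"
    unfolding L R .
  moreover have "Sum_any (\<lambda>\<omega>. \<Sum>p'<n \<omega>. \<Sum>q'<n \<omega>. ?\<phi> (\<omega>, p', q')) = sum ?\<phi> {y. dcoef n D y a b \<noteq> 0}"
    by (rule Sum_any_points[OF finite_dcoef]) (use dcoef_valid[of n D _ a b] in \<open>fastforce simp: valid_def\<close>)+
  moreover have "Sum_any (\<lambda>\<omega>. \<Sum>p'<n \<omega>. \<Sum>q'<n \<omega>. ?\<psi> (\<omega>, p', q')) = sum ?\<psi> {y. dcoef n D y b c \<noteq> 0}"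
    by (rule Sum_any_points[OF finite_dcoef]) (use dcoef_valid[of n D _ b c] in \<open>fastforce simp: valid_def\<close>)+
  ultimately show ?thesis by (simp add: comul_def)
qed

sublocale coalgebra "dcoef n D"
  by unfold_locales (fact finite_dcoef, fact dcoef_coassoc)

lemma comul_invalid:
  "\<not> valid n a \<or> \<not> valid n b \<Longrightarrow> comul (dcoef n D) \<phi> a b = 0"
  unfolding comul_def using dcoef_valid[of n D _ a b] by (auto intro!: sum.neutral)

lemma comul_entries_to_matrices: "comul (dcoef n D) (entries (to_matrices n \<phi>)) a b = comul (dcoef n D) \<phi> a b"
  by (rule comul_cong) (auto dest!: dcoef_valid simp: entries_def to_matrices_def valid_def)

end

section \<open>Stability\<close>

text \<open>Reversing the order of the legs exchanges the two sides of coassociativity.\<close>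

lemma coalgebra_flip: "coalgebra d \<Longrightarrow> coalgebra (\<lambda>c a b. d c b a)"
  unfolding coalgebra_def by (simp add: comul_flip[of d])

lemma unif_bounded_cong: "(\<And>a. valid n a \<Longrightarrow> \<phi> a = \<psi> a) \<Longrightarrow> unif_bounded n \<phi> C = unif_bounded n \<psi> C"
  unfolding unif_bounded_def valid_def by (intro all_cong1 op_bounded_cong) auto

lemma unif_bounded_kron_left:
  assumes "\<And>\<alpha> \<beta>. op_bounded (n \<alpha> * n \<beta>) (\<lambda>p q. G (\<alpha>, \<beta>) $$ (p, q)) C" "valid n b"
  shows "unif_bounded n (\<lambda>a. kron_entry n G a b) C"
proof -
  obtain \<beta> k l where "b = (\<beta>, k, l)" by (metis prod_cases3)
  then show ?thesis
    using op_bounded_lcoeff[OF assms(1)] assms(2) by (auto simp: unif_bounded_def valid_def)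
qed

lemma unif_bounded_kron_right:
  assumes "\<And>\<alpha> \<beta>. op_bounded (n \<alpha> * n \<beta>) (\<lambda>p q. G (\<alpha>, \<beta>) $$ (p, q)) C" "valid n a"
  shows "unif_bounded n (\<lambda>b. kron_entry n G a b) C"
proof -
  obtain \<alpha> s t where "a = (\<alpha>, s, t)" by (metis prod_cases3)
  then show ?thesis
    using op_bounded_rcoeff[OF assms(1)] assms(2) by (auto simp: unif_bounded_def valid_def)
qed

section \<open>Slice maps of the mean and their contractivity\<close>

context state_on
begin

lemma slice_left_entry:
  "i < n \<beta> \<Longrightarrow> j < n \<beta> \<Longrightarrow> slice_left n m G \<beta> $$ (i, j) = mean (\<lambda>a. kron_entry n G a (\<beta>, i, j))"
  by (simp add: slice_left_def mean_def to_matrices_def lcoeff_def)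

lemma slice_right_entry:
  "i < n \<alpha> \<Longrightarrow> j < n \<alpha> \<Longrightarrow> slice_right n m G \<alpha> $$ (i, j) = mean (\<lambda>b. kron_entry n G (\<alpha>, i, j) b)"
  by (simp add: slice_right_def mean_def to_matrices_def rcoeff_def)

lemma mean_0: "mean (\<lambda>a. 0) = 0"
  using mean_scale[OF unit_point_bounded_fun, of 0] by simp

lemma unif_bounded_mean_left:
  assumes G: "\<And>\<alpha> \<beta>. op_bounded (n \<alpha> * n \<beta>) (\<lambda>p q. G (\<alpha>, \<beta>) $$ (p, q)) C"
  shows "unif_bounded n (\<lambda>b. mean (\<lambda>a. kron_entry n G a b)) C"
  unfolding unif_bounded_def
proof
  fix \<beta>
  show "op_bounded (n \<beta>) (\<lambda>k l. mean (\<lambda>a. kron_entry n G a (\<beta>, k, l))) C"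
  proof (rule op_bounded_mean)
    show "(\<lambda>a. kron_entry n G a (\<beta>, k, l)) \<in> bounded_fun n" if "k < n \<beta>" "l < n \<beta>" for k l
      using unif_bounded_kron_left[where G = G, OF G, of "(\<beta>, k, l)"] that by (auto simp: bounded_fun_def valid_def)
    show "0 \<le> C" by (rule op_bounded_nonneg[OF G])
    show "unif_bounded n (\<lambda>a. \<Sum>k<n \<beta>. \<Sum>l<n \<beta>. cnj (z k) * w l * kron_entry n G a (\<beta>, k, l))
        (C * l2 (n \<beta>) z * l2 (n \<beta>) w)" for z w
      unfolding unif_bounded_def using op_bounded_slice_left[OF G] by simp
  qed
qed

lemma unif_bounded_mean_right:
  assumes G: "\<And>\<alpha> \<beta>. op_bounded (n \<alpha> * n \<beta>) (\<lambda>p q. G (\<alpha>, \<beta>) $$ (p, q)) C"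
  shows "unif_bounded n (\<lambda>a. mean (\<lambda>b. kron_entry n G a b)) C"
  unfolding unif_bounded_def
proof
  fix \<alpha>
  show "op_bounded (n \<alpha>) (\<lambda>s t. mean (\<lambda>b. kron_entry n G (\<alpha>, s, t) b)) C"
  proof (rule op_bounded_mean)
    show "(\<lambda>b. kron_entry n G (\<alpha>, s, t) b) \<in> bounded_fun n" if "s < n \<alpha>" "t < n \<alpha>" for s t
      using unif_bounded_kron_right[where G = G, OF G, of "(\<alpha>, s, t)"] that by (auto simp: bounded_fun_def valid_def)
    show "0 \<le> C" by (rule op_bounded_nonneg[OF G])
    show "unif_bounded n (\<lambda>b. \<Sum>s<n \<alpha>. \<Sum>t<n \<alpha>. cnj (y s) * x t * kron_entry n G (\<alpha>, s, t) b)
        (C * l2 (n \<alpha>) y * l2 (n \<alpha>) x)" for y x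
      unfolding unif_bounded_def using op_bounded_slice_right[OF G] by simp
  qed
qed

end

section \<open>Translating identities in the product algebra to pairs of points\<close>

lemma unit_point_invalid: "\<not> valid n b \<Longrightarrow> unit_point n b = 0"
  by (auto simp: valid_def unit_point_def split: prod.splits)

lemma Fsmult_Fone_entry:
  "i < n \<beta> \<Longrightarrow> j < n \<beta> \<Longrightarrow> Fsmult c (Fone n) \<beta> $$ (i, j) = c * unit_point n (\<beta>, i, j)"
  by (simp add: Fsmult_def Fone_def unit_point_def)

lemma kron_entry_Ftensor:
  assumes "f \<in> Falg n" "g \<in> Falg n" "valid n a" "valid n b"
  shows "kron_entry n (Ftensor f g) a b = entries f a * entries g b"
proof -
  obtain \<alpha> s t \<beta> k l where ab: "a = (\<alpha>, s, t)" "b = (\<beta>, k, l)" by (metis prod_cases3)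
  have "f \<alpha> \<in> carrier_mat (n \<alpha>) (n \<alpha>)" "g \<beta> \<in> carrier_mat (n \<beta>) (n \<beta>)"
    using assms by (auto simp: Falg_def)
  then show ?thesis
    using assms(3,4) by (simp add: ab valid_def Ftensor_def kron_def entries_def less_kron_index)
qed

lemma Fone_Falg: "Fone n \<in> Falg n"
  by (simp add: Fone_def Falg_def)

lemma entries_Fone: "valid n a \<Longrightarrow> entries (Fone n) a = unit_point n a"
  by (auto simp: valid_def entries_def Fone_def unit_point_def split: prod.splits)

abbreviation prod_dim :: "('i \<Rightarrow> nat) \<Rightarrow> 'i \<times> 'i \<Rightarrow> nat" where
  "prod_dim n \<equiv> \<lambda>(\<alpha>, \<beta>). n \<alpha> * n \<beta>"

lemma Ftensor_Falg:
  assumes "f \<in> Falg n" "g \<in> Falg n"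
  shows "Ftensor f g \<in> Falg (prod_dim n)"
proof -
  have "Ftensor f g (\<alpha>, \<beta>) \<in> carrier_mat (n \<alpha> * n \<beta>) (n \<alpha> * n \<beta>)" for \<alpha> \<beta>
  proof -
    have "f \<alpha> \<in> carrier_mat (n \<alpha>) (n \<alpha>)" "g \<beta> \<in> carrier_mat (n \<beta>) (n \<beta>)"
      using assms by (auto simp: Falg_def)
    then show ?thesis by (auto simp: Ftensor_def kron_def)
  qed
  then show ?thesis by (simp add: Falg_def case_prod_beta split_paired_all)
qed

lemma comult_Falg: "comult n D f \<in> Falg (prod_dim n)"
  by (auto simp: Falg_def comult_def mat_Sum_def)

lemma Falg_add: "f \<in> Falg n \<Longrightarrow> g \<in> Falg n \<Longrightarrow> f + g \<in> Falg n"
  by (simp add: Falg_def)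

lemma Falg_diff: "f \<in> Falg n \<Longrightarrow> g \<in> Falg n \<Longrightarrow> f - g \<in> Falg n"
  by (simp add: Falg_def minus_carrier_mat)

lemma kron_entry_add:
  assumes "G \<in> Falg (prod_dim n)" "H \<in> Falg (prod_dim n)" "valid n a" "valid n b"
  shows "kron_entry n (G + H) a b = kron_entry n G a b + kron_entry n H a b"
proof -
  obtain \<alpha> s t \<beta> k l where ab: "a = (\<alpha>, s, t)" "b = (\<beta>, k, l)" by (metis prod_cases3)
  have "H (\<alpha>, \<beta>) \<in> carrier_mat (n \<alpha> * n \<beta>) (n \<alpha> * n \<beta>)"
    using assms(2) by (force simp: Falg_def)
  then show ?thesis using assms(3,4) by (simp add: ab valid_def less_kron_index)
qed

lemma kron_entry_diff:
  assumes "G \<in> Falg (prod_dim n)" "H \<in> Falg (prod_dim n)" "valid n a" "valid n b"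
  shows "kron_entry n (G - H) a b = kron_entry n G a b - kron_entry n H a b"
proof -
  obtain \<alpha> s t \<beta> k l where ab: "a = (\<alpha>, s, t)" "b = (\<beta>, k, l)" by (metis prod_cases3)
  have "H (\<alpha>, \<beta>) \<in> carrier_mat (n \<alpha> * n \<beta>) (n \<alpha> * n \<beta>)"
    using assms(2) by (force simp: Falg_def)
  then show ?thesis using assms(3,4) by (simp add: ab valid_def less_kron_index)
qed

lemma Falg_prod_eqI:
  assumes "G \<in> Falg (prod_dim n)" "H \<in> Falg (prod_dim n)"
    and "\<And>a b. valid n a \<Longrightarrow> valid n b \<Longrightarrow> kron_entry n G a b = kron_entry n H a b"
  shows "G = H"
proof (rule ext, clarify)
  fix \<alpha> \<beta>
  have GH: "G (\<alpha>, \<beta>) \<in> carrier_mat (n \<alpha> * n \<beta>) (n \<alpha> * n \<beta>)" "H (\<alpha>, \<beta>) \<in> carrier_mat (n \<alpha> * n \<beta>) (n \<alpha> * n \<beta>)"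
    using assms(1,2) by (force simp: Falg_def)+
  show "G (\<alpha>, \<beta>) = H (\<alpha>, \<beta>)"
  proof (rule eq_matI)
    fix p q assume "p < dim_row (H (\<alpha>, \<beta>))" "q < dim_col (H (\<alpha>, \<beta>))"
    then have "p < n \<alpha> * n \<beta>" "q < n \<alpha> * n \<beta>" using GH by auto
    then obtain s k t l where "s < n \<alpha>" "k < n \<beta>" "p = s * n \<beta> + k" "t < n \<alpha>" "l < n \<beta>" "q = t * n \<beta> + l"
      by (metis kron_index_cases)
    then show "G (\<alpha>, \<beta>) $$ (p, q) = H (\<alpha>, \<beta>) $$ (p, q)"
      using assms(3)[of "(\<alpha>, s, t)" "(\<beta>, k, l)"] by (simp add: valid_def)
  qed (use GH in auto)
qed

section \<open>Invariant means and the additive correction\<close>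

locale comult_state = comult_system n D + state_on n m
  for n :: "'i \<Rightarrow> nat" and D :: "'i comult_family" and m :: "('i \<Rightarrow> complex mat) \<Rightarrow> complex"
begin

abbreviation d :: "'i point \<Rightarrow> 'i point \<Rightarrow> 'i point \<Rightarrow> complex" where
  "d \<equiv> dcoef n D"

lemma comult_to_matrices_entry:
  "valid n a \<Longrightarrow> valid n b \<Longrightarrow> kron_entry n (comult n D (to_matrices n \<phi>)) a b = comul d \<phi> a b"
  by (simp add: comult_entry to_matrices_Falg comul_entries_to_matrices)

lemma comul_unit_left_bounded_fun: "(\<lambda>a. comul d (unit_point n) a b) \<in> bounded_fun n"
proof (cases "valid n b")
  case True
  have "unif_bounded n (\<lambda>a. comul d (unit_point n) a b) 1"
    using unif_bounded_kron_left[where G = "comult n D (Fone n)", OF op_bounded_comult_Fone True]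
    by (subst unif_bounded_cong[where \<psi> = "\<lambda>a. kron_entry n (comult n D (Fone n)) a b"])
      (simp_all add: comult_to_matrices_entry True flip: to_matrices_unit_point)
  then show ?thesis by (auto simp: bounded_fun_def)
next
  case False
  then show ?thesis using bounded_fun_scale[OF unit_point_bounded_fun, of 0] by (simp add: comul_invalid)
qed

lemma comul_unit_right_bounded_fun: "(\<lambda>b. comul d (unit_point n) a b) \<in> bounded_fun n"
proof (cases "valid n a")
  case True
  have "unif_bounded n (\<lambda>b. comul d (unit_point n) a b) 1"
    using unif_bounded_kron_right[where G = "comult n D (Fone n)", OF op_bounded_comult_Fone True]
    by (subst unif_bounded_cong[where \<psi> = "\<lambda>b. kron_entry n (comult n D (Fone n)) a b"])
      (simp_all add: comult_to_matrices_entry True flip: to_matrices_unit_point)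
  then show ?thesis by (auto simp: bounded_fun_def)
next
  case False
  then show ?thesis using bounded_fun_scale[OF unit_point_bounded_fun, of 0] by (simp add: comul_invalid)
qed

lemma mean_cong_valid: "(\<And>a. valid n a \<Longrightarrow> \<phi> a = \<psi> a) \<Longrightarrow> mean \<phi> = mean \<psi>"
  by (rule mean_cong) (simp add: valid_def)

lemma mean_right_invariant:
  assumes "\<forall>f \<in> Fb n. slice_left n m (comult n D f) = Fsmult (m f) (Fone n)" and "\<phi> \<in> bounded_fun n"
  shows "mean (\<lambda>a. comul d \<phi> a b) = mean \<phi> * unit_point n b"
proof (cases "valid n b")
  case True
  obtain \<beta> i j where b: "b = (\<beta>, i, j)" by (metis prod_cases3)
  have "mean (\<lambda>a. comul d \<phi> a b) = mean (\<lambda>a. kron_entry n (comult n D (to_matrices n \<phi>)) a b)"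
    by (rule mean_cong_valid) (simp add: comult_to_matrices_entry True)
  also have "\<dots> = slice_left n m (comult n D (to_matrices n \<phi>)) \<beta> $$ (i, j)"
    using True by (simp add: b valid_def slice_left_entry)
  also have "\<dots> = mean \<phi> * unit_point n b"
    using True assms by (simp add: b valid_def to_matrices_Fb Fsmult_Fone_entry mean_def)
  finally show ?thesis .
next
  case False
  then show ?thesis by (simp add: comul_invalid mean_0 unit_point_invalid)
qed

lemma mean_left_invariant:
  assumes "\<forall>f \<in> Fb n. slice_right n m (comult n D f) = Fsmult (m f) (Fone n)" and "\<phi> \<in> bounded_fun n"
  shows "mean (\<lambda>b. comul d \<phi> a b) = mean \<phi> * unit_point n a"
proof (cases "valid n a")
  case True
  obtain \<alpha> i j where a: "a = (\<alpha>, i, j)" by (metis prod_cases3)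
  have "mean (\<lambda>b. comul d \<phi> a b) = mean (\<lambda>b. kron_entry n (comult n D (to_matrices n \<phi>)) a b)"
    by (rule mean_cong_valid) (simp add: comult_to_matrices_entry True)
  also have "\<dots> = slice_right n m (comult n D (to_matrices n \<phi>)) \<alpha> $$ (i, j)"
    using True by (simp add: a valid_def slice_right_entry)
  also have "\<dots> = mean \<phi> * unit_point n a"
    using True assms by (simp add: a valid_def to_matrices_Fb Fsmult_Fone_entry mean_def)
  finally show ?thesis .
next
  case False
  then show ?thesis by (simp add: comul_invalid mean_0 unit_point_invalid)
qed

lemma additive_to_matrices:
  assumes "\<And>a b. comul d \<psi> a b = unit_point n a * \<psi> b + \<psi> a * unit_point n b"
  shows "comult n D (to_matrices n \<psi>) = Ftensor (Fone n) (to_matrices n \<psi>) + Ftensor (to_matrices n \<psi>) (Fone n)"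
proof (rule Falg_prod_eqI)
  show "Ftensor (Fone n) (to_matrices n \<psi>) + Ftensor (to_matrices n \<psi>) (Fone n) \<in> Falg (prod_dim n)"
    by (intro Falg_add Ftensor_Falg Fone_Falg to_matrices_Falg)
  fix a b assume ab: "valid n a" "valid n b"
  have "entries (to_matrices n \<psi>) c = \<psi> c" if "valid n c" for c
    using that by (auto simp: valid_def entries_def to_matrices_def split: prod.splits)
  then show "kron_entry n (comult n D (to_matrices n \<psi>)) a b =
      kron_entry n (Ftensor (Fone n) (to_matrices n \<psi>) + Ftensor (to_matrices n \<psi>) (Fone n)) a b"
    using ab assms[of a b]
    by (simp add: comult_to_matrices_entry kron_entry_add kron_entry_Ftensor Ftensor_Falg Fone_Falg
        to_matrices_Falg entries_Fone)
qed (rule comult_Falg)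

text \<open>The function \<open>g\<close> of \<open>additive_correction\<close>, with
  \<open>unit_point n\<close> as the unit and \<open>entries f\<close> as the function.\<close>

definition defect :: "('i \<Rightarrow> complex mat) \<Rightarrow> 'i point \<Rightarrow> 'i point \<Rightarrow> complex" where
  "defect f a b = comul d (entries f) a b - unit_point n a * entries f b - entries f a * unit_point n b"

lemma defect_entry:
  assumes "f \<in> Falg n" "valid n a" "valid n b"
  shows "kron_entry n (comult n D f - Ftensor (Fone n) f - Ftensor f (Fone n)) a b = defect f a b"
  using assms
  by (simp add: kron_entry_diff kron_entry_Ftensor comult_entry comult_Falg Ftensor_Falg Fone_Falg
      Falg_diff entries_Fone defect_def)

lemma op_bounded_of_Fnorm_le:
  assumes "G \<in> Falg (prod_dim n)" "Fnorm G \<le> ennreal C" "0 \<le> C"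
  shows "op_bounded (n \<alpha> * n \<beta>) (\<lambda>p q. G (\<alpha>, \<beta>) $$ (p, q)) C"
proof -
  have "unif_bounded (prod_dim n) (entries G) C"
    using assms to_matrices_entries[OF assms(1)] Fnorm_to_matrices_le[of C "prod_dim n" "entries G"] by simp
  from this[unfolded unif_bounded_def, rule_format, of "(\<alpha>, \<beta>)"] show ?thesis
    by (simp add: entries_def)
qed

lemma defect_bound:
  assumes f: "f \<in> Falg n"
    and "Fnorm (comult n D f - Ftensor (Fone n) f - Ftensor f (Fone n)) \<le> ennreal C" "0 \<le> C"
  shows "(\<lambda>a. defect f a b) \<in> bounded_fun n" "(\<lambda>b. defect f a b) \<in> bounded_fun n"
    and "unif_bounded n (\<lambda>b. mean (\<lambda>a. defect f a b)) C" "unif_bounded n (\<lambda>a. mean (\<lambda>b. defect f a b)) C"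
proof -
  let ?G = "comult n D f - Ftensor (Fone n) f - Ftensor f (Fone n)"
  have G: "op_bounded (n \<alpha> * n \<beta>) (\<lambda>p q. ?G (\<alpha>, \<beta>) $$ (p, q)) C" for \<alpha> \<beta>
    by (intro op_bounded_of_Fnorm_le Falg_diff comult_Falg Ftensor_Falg Fone_Falg assms)
  show "(\<lambda>a. defect f a b) \<in> bounded_fun n"
  proof (cases "valid n b")
    case True
    have "unif_bounded n (\<lambda>a. defect f a b) C"
      using unif_bounded_kron_left[where G = ?G, OF G True]
      by (subst unif_bounded_cong[where \<psi> = "\<lambda>a. kron_entry n ?G a b"]) (simp_all add: defect_entry f True)
    then show ?thesis by (auto simp: bounded_fun_def)
  next
    \<comment> \<open>For such b the image of f and the unit both vanish at b. What remains is the
      unit times the junk value of -\<open>entries f b\<close>, still a bounded function of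
      a.\<close>
    case False
    then show ?thesis
      using bounded_fun_scale[OF unit_point_bounded_fun, of "- entries f b" n]
      by (simp add: defect_def comul_invalid unit_point_invalid mult.commute)
  qed
  show "(\<lambda>b. defect f a b) \<in> bounded_fun n"
  proof (cases "valid n a")
    case True
    have "unif_bounded n (\<lambda>b. defect f a b) C"
      using unif_bounded_kron_right[where G = ?G, OF G True]
      by (subst unif_bounded_cong[where \<psi> = "\<lambda>b. kron_entry n ?G a b"]) (simp_all add: defect_entry f True)
    then show ?thesis by (auto simp: bounded_fun_def)
  next
    case False
    then show ?thesis
      using bounded_fun_scale[OF unit_point_bounded_fun, of "- entries f a" n]
      by (simp add: defect_def comul_invalid unit_point_invalid)
  qed
  show "unif_bounded n (\<lambda>b. mean (\<lambda>a. defect f a b)) C"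
  proof (subst unif_bounded_cong)
    show "mean (\<lambda>a. defect f a b) = mean (\<lambda>a. kron_entry n ?G a b)" if "valid n b" for b
      by (rule mean_cong_valid) (simp add: defect_entry f that)
  qed (rule unif_bounded_mean_left[OF G])
  show "unif_bounded n (\<lambda>a. mean (\<lambda>b. defect f a b)) C"
  proof (subst unif_bounded_cong)
    show "mean (\<lambda>b. defect f a b) = mean (\<lambda>b. kron_entry n ?G a b)" if "valid n a" for a
      by (rule mean_cong_valid) (simp add: defect_entry f that)
  qed (rule unif_bounded_mean_right[OF G])
qed

lemma Fnorm_correction:
  assumes "f \<in> Falg n" "unif_bounded n u C" "0 \<le> C"
  shows "Fnorm (to_matrices n (\<lambda>a. entries f a + u a) - f) \<le> ennreal C"
proof -
  have "to_matrices n (\<lambda>a. entries f a + u a) - f = to_matrices n u"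
  proof
    fix \<alpha>
    have "f \<alpha> \<in> carrier_mat (n \<alpha>) (n \<alpha>)" using assms by (simp add: Falg_def)
    then show "(to_matrices n (\<lambda>a. entries f a + u a) - f) \<alpha> = to_matrices n u \<alpha>"
      by (intro eq_matI) (auto simp: to_matrices_def entries_def)
  qed
  then show ?thesis using assms by (simp add: Fnorm_to_matrices_le)
qed

lemma right_invariant_stability:
  assumes inv: "\<forall>f \<in> Fb n. slice_left n m (comult n D f) = Fsmult (m f) (Fone n)"
    and f: "f \<in> Falg n"
    and C: "Fnorm (comult n D f - Ftensor (Fone n) f - Ftensor f (Fone n)) \<le> ennreal C" "0 \<le> C"
  shows "\<exists>F \<in> Falg n. comult n D F = Ftensor (Fone n) F + Ftensor F (Fone n) \<and> Fnorm (F - f) \<le> ennreal C"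
proof -
  interpret mean_coalgebra d "unit_point n" "bounded_fun n" mean
    by unfold_locales (simp_all add: bounded_fun_add bounded_fun_scale unit_point_bounded_fun comul_unit_left_bounded_fun
        mean_add mean_scale mean_unit mean_right_invariant[OF inv])
  have "comul d (\<lambda>b. entries f b + mean (\<lambda>a. defect f a b)) a b =
      unit_point n a * (entries f b + mean (\<lambda>a. defect f a b)) +
      (entries f a + mean (\<lambda>a'. defect f a' a)) * unit_point n b" for a b
    unfolding defect_def
    by (rule additive_correction[of "entries f"]) (use defect_bound(1)[OF f C] in \<open>simp add: defect_def\<close>)
  from additive_to_matrices[OF this] show ?thesis
    using Fnorm_correction[OF f defect_bound(3)[OF f C] C(2)] to_matrices_Falg by blast
qed

lemma left_invariant_stability:
  assumes inv: "\<forall>f \<in> Fb n. slice_right n m (comult n D f) = Fsmult (m f) (Fone n)"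
    and f: "f \<in> Falg n"
    and C: "Fnorm (comult n D f - Ftensor (Fone n) f - Ftensor f (Fone n)) \<le> ennreal C" "0 \<le> C"
  shows "\<exists>F \<in> Falg n. comult n D F = Ftensor (Fone n) F + Ftensor F (Fone n) \<and> Fnorm (F - f) \<le> ennreal C"
proof -
  interpret op: coalgebra "\<lambda>c a b. d c b a"
    by (rule coalgebra_flip) unfold_locales
  interpret op: mean_coalgebra "\<lambda>c a b. d c b a" "unit_point n" "bounded_fun n" mean
    by unfold_locales (simp_all add: bounded_fun_add bounded_fun_scale unit_point_bounded_fun comul_unit_right_bounded_fun comul_flip[of d]
        mean_add mean_scale mean_unit mean_left_invariant[OF inv])
  have op_defect: "defect f b a = comul (\<lambda>c a b. d c b a) (entries f) a b
      - unit_point n a * entries f b - entries f a * unit_point n b" for a b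
    by (simp add: defect_def comul_flip[of d] algebra_simps)
  \<comment> \<open>The arguments are taken in the order b, a so that the flipped comultiplication
    turns into the original one at (a, b).\<close>
  have "comul (\<lambda>c a b. d c b a) (\<lambda>b. entries f b + mean (\<lambda>a. defect f b a)) b a =
      unit_point n b * (entries f a + mean (\<lambda>b. defect f a b)) +
      (entries f b + mean (\<lambda>a. defect f b a)) * unit_point n a" for a b
    unfolding op_defect
    by (rule op.additive_correction[of "entries f"]) (use defect_bound(2)[OF f C] in \<open>simp add: op_defect\<close>)
  then have "comul d (\<lambda>b. entries f b + mean (\<lambda>a. defect f b a)) a b =
      unit_point n a * (entries f b + mean (\<lambda>a. defect f b a)) +
      (entries f a + mean (\<lambda>b. defect f a b)) * unit_point n b" for a b
    by (simp add: comul_flip[of d] mult.commute add.commute)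
  from additive_to_matrices[OF this] show ?thesis
    using Fnorm_correction[OF f defect_bound(4)[OF f C] C(2)] to_matrices_Falg by blast
qed

end

theorem theorem2:
  fixes n :: "'i \<Rightarrow> nat"
    and D :: "'i \<Rightarrow> 'i \<Rightarrow> 'i \<Rightarrow> complex mat \<Rightarrow> complex mat"
  assumes "discrete_quantum_semigroup n D"
    and "left_amenable n D \<or> right_amenable n D"
  shows "\<forall>r > (0::real). \<exists>r' > (0::real). \<forall>f \<in> Falg n.
           Fnorm (comult n D f - Ftensor (Fone n) f - Ftensor f (Fone n)) < ennreal r' \<longrightarrow>
           (\<exists>F \<in> Falg n. comult n D F = Ftensor (Fone n) F + Ftensor F (Fone n) \<and>
                         Fnorm (F - f) < ennreal r)"
proof (intro allI impI)
  fix r :: real assume r: "r > 0"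
  have D: "comultiplication n D" using assms(1) by (simp add: discrete_quantum_semigroup_def)
  have "\<exists>F \<in> Falg n. comult n D F = Ftensor (Fone n) F + Ftensor F (Fone n) \<and> Fnorm (F - f) < ennreal r"
    if f: "f \<in> Falg n" and lt: "Fnorm (comult n D f - Ftensor (Fone n) f - Ftensor f (Fone n)) < ennreal r" for f
  proof -
    \<comment> \<open>Working with the exact norm \<open>C\<close> of the defect keeps the
      conclusion strict: the correction has norm at most \<open>C\<close>, and \<open>C\<close> is
      below r.\<close>
    obtain C where C: "0 \<le> C" "Fnorm (comult n D f - Ftensor (Fone n) f - Ftensor f (Fone n)) = ennreal C"
      using lt by (cases "Fnorm (comult n D f - Ftensor (Fone n) f - Ftensor f (Fone n))") auto
    have "\<exists>F \<in> Falg n. comult n D F = Ftensor (Fone n) F + Ftensor F (Fone n) \<and> Fnorm (F - f) \<le> ennreal C"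
      using assms(2)
    proof
      assume "left_amenable n D"
      then obtain m where m: "state n m"
        "\<forall>f \<in> Fb n. slice_right n m (comult n D f) = Fsmult (m f) (Fone n)"
        by (auto simp: left_amenable_def)
      interpret comult_state n D m by unfold_locales (fact D, fact m(1))
      show ?thesis using left_invariant_stability[OF m(2) f] C by simp
    next
      assume "right_amenable n D"
      then obtain m where m: "state n m"
        "\<forall>f \<in> Fb n. slice_left n m (comult n D f) = Fsmult (m f) (Fone n)"
        by (auto simp: right_amenable_def)
      interpret comult_state n D m by unfold_locales (fact D, fact m(1))
      show ?thesis using right_invariant_stability[OF m(2) f] C by simp
    qed
    then show ?thesis using lt unfolding C(2) by (blast intro: le_less_trans)
  qed
  then show "\<exists>r' > (0::real). \<forall>f \<in> Falg n.
           Fnorm (comult n D f - Ftensor (Fone n) f - Ftensor f (Fone n)) < ennreal r' \<longrightarrow>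
           (\<exists>F \<in> Falg n. comult n D F = Ftensor (Fone n) F + Ftensor F (Fone n) \<and>
                         Fnorm (F - f) < ennreal r)"
    using r by blast
qed

end
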